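(* For every $\varepsilon\in(0,1)$ there exist a non-pseudoconvex bounded domain $D\subset\mathbb C^2$ with $C^{1,1-\varepsilon}$-smooth boundary and a negative plurisubharmonic function $u$ on $D$ (i.e. $u<0$ on $D$) such that $\limsup_{D\ni z\to a}u(z)=0$ for every $a\in\partial D$. In particular, $v:=-\log(-u)$ is plurisubharmonic on $D$ and $\limsup_{D\ni z\to a}v(z)=\infty$ for every $a\in\partial D$.
   Context: A domain is a connected open set. $C^{1,1-\varepsilon}$-smooth boundary means that the boundary is locally given by a $C^1$ defining function with nonvanishing gradient whose first derivatives are Hölder continuous of order $1-\varepsilon$. Plurisubharmonic functions may take the value $-\infty$ (with the convention $-\log(+\infty)=-\infty$). *)

theory Defs
  imports "HOL-Analysis.Analysis"
begin

definition domain :: "'a::topological_space set \<Rightarrow> bool" where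
  "domain D \<longleftrightarrow> open D \<and> connected D \<and> D \<noteq> {}"

definition usc_on :: "'a::topological_space set \<Rightarrow> ('a \<Rightarrow> ereal) \<Rightarrow> bool" where
  "usc_on S u \<longleftrightarrow> (\<forall>x\<in>S. \<forall>c. u x < c \<longrightarrow> (\<forall>\<^sub>F y in at x within S. u y < c))"

(* The average of u over the circle with centre a and radius r, as an extended real number.
   The integral is the difference of the integrals of the positive and the negative part
   (e2ennreal sends negative arguments to 0).  If u is upper semicontinuous and < \<infinity> on the
   circle, then the first integral is finite, so the case \<infinity> - \<infinity> does not arise. *)
definition circle_mean :: "(complex \<Rightarrow> ereal) \<Rightarrow> complex \<Rightarrow> real \<Rightarrow> ereal" where
  "circle_mean u a r =
     (enn2ereal (\<integral>\<^sup>+t\<in>{0..2*pi}. e2ennreal (u (a + of_real r * cis t)) \<partial>lborel)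
      - enn2ereal (\<integral>\<^sup>+t\<in>{0..2*pi}. e2ennreal (- u (a + of_real r * cis t)) \<partial>lborel))
     / ereal (2 * pi)"

(* The function that is constantly -\<infinity> is counted as subharmonic, as is needed for the
   restrictions to complex lines in the definition of plurisubharmonicity. *)
definition subharmonic_on :: "complex set \<Rightarrow> (complex \<Rightarrow> ereal) \<Rightarrow> bool" where
  "subharmonic_on S u \<longleftrightarrow>
     usc_on S u \<and> (\<forall>z\<in>S. u z < \<infinity>) \<and>
     (\<forall>a r. 0 < r \<and> cball a r \<subseteq> S \<longrightarrow> u a \<le> circle_mean u a r)"

definition plurisubharmonic_on :: "(complex ^ 'n) set \<Rightarrow> (complex ^ 'n \<Rightarrow> ereal) \<Rightarrow> bool" where
  "plurisubharmonic_on D u \<longleftrightarrow>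
     usc_on D u \<and> (\<forall>z\<in>D. u z < \<infinity>) \<and>
     (\<forall>a b. subharmonic_on {\<zeta>. a + \<zeta> *s b \<in> D} (\<lambda>\<zeta>. u (a + \<zeta> *s b)))"

(* Existence of a continuous plurisubharmonic exhaustion function. *)
definition pseudoconvex :: "(complex ^ 'n) set \<Rightarrow> bool" where
  "pseudoconvex D \<longleftrightarrow>
     open D \<and>
     (\<exists>\<phi> :: complex ^ 'n \<Rightarrow> real.
        continuous_on D \<phi> \<and>
        plurisubharmonic_on D (\<lambda>z. ereal (\<phi> z)) \<and>
        (\<forall>c. compact (closure {z\<in>D. \<phi> z < c}) \<and> closure {z\<in>D. \<phi> z < c} \<subseteq> D))"

definition holder_on ::
  "real \<Rightarrow> 'a::metric_space set \<Rightarrow> ('a \<Rightarrow> 'b::metric_space) \<Rightarrow> bool" where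
  "holder_on \<alpha> S f \<longleftrightarrow> (\<exists>C. \<forall>x\<in>S. \<forall>y\<in>S. dist (f x) (f y) \<le> C * dist x y powr \<alpha>)"

(* C^{1,\<alpha>} boundary, for \<alpha> > 0.  Here g is the gradient of the local defining function \<rho>;
   its continuity follows from the Hoelder condition.  Since g does not vanish, the condition
   on D also gives frontier D \<inter> U = {z \<in> U. \<rho> z = 0} when D is open. *)
definition C1_holder_boundary :: "real \<Rightarrow> 'a::euclidean_space set \<Rightarrow> bool" where
  "C1_holder_boundary \<alpha> D \<longleftrightarrow>
     (\<forall>p\<in>frontier D. \<exists>U \<rho> g.
        open U \<and> p \<in> U \<and>
        (\<forall>z\<in>U. (GDERIV \<rho> z :> g z) \<and> g z \<noteq> 0) \<and>
        holder_on \<alpha> U g \<and>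
        D \<inter> U = {z\<in>U. \<rho> z < 0})"

(* The logarithm on (0, \<infinity>], with log \<infinity> = \<infinity>; only used for positive arguments. *)
definition log_ereal :: "ereal \<Rightarrow> ereal" where
  "log_ereal x = (if x = \<infinity> then \<infinity> else ereal (ln (real_of_ereal x)))"

end

theory Submission
  imports Defs
begin

text \<open>
  The condition on \<open>u\<close> only concerns a dense set of boundary points: the set of boundary points at
  which the upper limit of \<open>u\<close> is \<open>0\<close> is closed. So the boundary may be pseudoconcave at some points, as
  long as arbitrarily close to them there are points at which \<open>D\<close> has a local barrier. A boundary of
  class \<open>C\<^sup>2\<close> does not allow this, because strict pseudoconcavity is an open condition there; a
  boundary with Hoelder continuous derivatives does, because it can have a dense set of points at
  which it is touched from the outside of \<open>D\<close> by strictly convex hypersurfaces.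

  Let \<open>h\<close> be a small function on the line whose derivative \<open>p\<close> is Hoelder continuous of order
  \<open>\<alpha> = 1 - \<epsilon>\<close>, nondecreasing, and increasing with infinite slope at every rational point; it is
  obtained from \<open>\<Sum>j. 2\<^sup>-\<^sup>j sgn (x - q\<^sub>j) \<bar>x - q\<^sub>j\<bar>\<^sup>\<alpha>\<close>, the \<open>q\<^sub>j\<close> being the rational numbers
  (\<open>ex_kinked_profile\<close>). Put \<open>g z = \<bar>z\<bar>\<^sup>4 - \<bar>z\<bar>\<^sup>2 + h (Re z) + h (Im z)\<close> and
  \<open>D = {(z, w). \<bar>w\<bar>\<^sup>2 + g z < 1}\<close>.

  \<^item> Seen on a macroscopic scale \<open>g\<close> has a local maximum near \<open>0\<close>, because of the term \<open>- \<bar>z\<bar>\<^sup>2\<close> and the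
    smallness of \<open>h\<close>. Discs parallel to the \<open>z\<close>-axis over this maximum touch the boundary with their
    centres while their boundary circles stay in a compact subset of \<open>D\<close>. So no continuous plurisubharmonic
    function on \<open>D\<close> has relatively compact sublevel sets (\<open>not_pseudoconvex_D\<close>).

  \<^item> On a microscopic scale, at points \<open>z\<^sub>0\<close> with rational coordinates, the kinks of \<open>h\<close> dominate the
    term \<open>- \<bar>z\<bar>\<^sup>2\<close>, and \<open>g\<close> lies above its tangent at \<open>z\<^sub>0\<close> by at least \<open>\<bar>z - z\<^sub>0\<bar>\<^sup>2\<close> (\<open>g_kink\<close>).
    Replacing \<open>g\<close> by this tangent in the defining function gives a convex function \<open>P\<close> that is
    negative on the nearby part of \<open>D\<close> and bounded away from \<open>0\<close> except close to the circle
    \<open>z = z\<^sub>0\<close>, \<open>\<bar>w\<bar>\<^sup>2 = 1 - g z\<^sub>0\<close> of boundary points, on which it vanishes. For small \<open>\<gamma> > 0\<close>, the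
    function \<open>max (-1) (P / \<gamma>)\<close> extends by \<open>-1\<close> to all of \<open>D\<close> (\<open>barrier\<close>).

  The supports of these barriers (the sets where they exceed \<open>-1\<close>) can be made as close to the
  boundary as desired. So their supremum over a countable dense set of \<open>z\<^sub>0\<close> is locally a maximum of
  finitely many functions: it is negative, it is at least as large as each barrier, and it has upper
  limit \<open>0\<close> at a dense set of boundary points, hence at all of them (\<open>ex_supported_exhaustion\<close>).

  All functions involved have an affine minorant at each point, valid on every segment in \<open>D\<close>
  that starts there. This property, a localized form of convexity, is stable under suprema and under
  \<open>t \<mapsto> - ln (- t)\<close>, and it implies plurisubharmonicity, because the mean of a real affine function
  over a circle is its value at the centre (\<open>plurisubharmonic_on_supported\<close>).
\<close>

section \<open>Hoelder continuous functions with infinite slope at the rational numbers\<close>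

lemma powr_subadditive:
  fixes a b \<alpha> :: real
  assumes "0 \<le> a" "0 \<le> b" "0 < \<alpha>" "\<alpha> \<le> 1"
  shows "(a + b) powr \<alpha> \<le> a powr \<alpha> + b powr \<alpha>"
proof (cases "a + b = 0")
  case True
  then show ?thesis using assms by simp
next
  case False
  define s where "s = a + b"
  have s: "s > 0" using False assms unfolding s_def by linarith
  have *: "x / s \<le> x powr \<alpha> / s powr \<alpha>" if "0 \<le> x" "x \<le> s" for x
  proof -
    have "(x / s) powr 1 \<le> (x / s) powr \<alpha>"
      using that s assms by (intro powr_mono') auto
    then show ?thesis using that s by (simp add: powr_divide)
  qed
  have "1 = a / s + b / s" using s by (simp add: s_def add_divide_distrib [symmetric])
  also have "\<dots> \<le> a powr \<alpha> / s powr \<alpha> + b powr \<alpha> / s powr \<alpha>"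
    using assms by (intro add_mono *) (auto simp: s_def)
  finally show ?thesis
    using s unfolding s_def [symmetric] by (simp add: field_simps)
qed

lemma isCont_if_holder:
  fixes f :: "real \<Rightarrow> real"
  assumes "0 < \<alpha>" "\<And>y. \<bar>f y - f x\<bar> \<le> C * \<bar>y - x\<bar> powr \<alpha>"
  shows "isCont f x"
  unfolding isCont_def
proof (rule LIM_zero_cancel, rule Lim_null_comparison)
  have "((\<lambda>y. \<bar>y - x\<bar>) \<longlongrightarrow> 0) (at x)" by (auto intro!: tendsto_eq_intros)
  then have "((\<lambda>y. \<bar>y - x\<bar> powr \<alpha>) \<longlongrightarrow> 0 powr \<alpha>) (at x)"
    using assms(1) by (intro tendsto_powr2) (auto simp: eventually_at_filter)
  then show "((\<lambda>y. C * \<bar>y - x\<bar> powr \<alpha>) \<longlongrightarrow> 0) (at x)"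
    using assms(1) by (auto intro!: tendsto_eq_intros)
qed (use assms(2) in auto)

text \<open>
  The truncation at \<open>1\<close> makes the function bounded, so that it can be translated to arbitrary
  rational numbers and summed with geometric weights.
\<close>

definition signed_powr :: "real \<Rightarrow> real \<Rightarrow> real" where
  "signed_powr \<alpha> t = sgn t * min 1 (\<bar>t\<bar> powr \<alpha>)"

lemma abs_signed_powr_le_1: "\<bar>signed_powr \<alpha> t\<bar> \<le> 1"
  by (auto simp: signed_powr_def abs_mult sgn_if)

lemma signed_powr_0 [simp]: "signed_powr \<alpha> 0 = 0"
  by (simp add: signed_powr_def)

lemma signed_powr_minus: "signed_powr \<alpha> (- t) = - signed_powr \<alpha> t"
  by (simp add: signed_powr_def sgn_minus)

lemma mono_signed_powr:
  assumes "0 < \<alpha>" shows "mono (signed_powr \<alpha>)"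
proof
  fix x y :: real assume "x \<le> y"
  consider "0 \<le> x" | "x < 0" "0 \<le> y" | "y < 0" by linarith
  then show "signed_powr \<alpha> x \<le> signed_powr \<alpha> y"
  proof cases
    case 1
    then show ?thesis using \<open>x \<le> y\<close> powr_mono2[of \<alpha> x y] assms
      by (auto simp: signed_powr_def sgn_if)
  next
    case 2
    have "signed_powr \<alpha> x \<le> 0" "0 \<le> signed_powr \<alpha> y"
      using 2 by (auto simp: signed_powr_def sgn_if)
    then show ?thesis by linarith
  next
    case 3
    then show ?thesis using \<open>x \<le> y\<close> powr_mono2[of \<alpha> "-y" "-x"] assms
      by (auto simp: signed_powr_def sgn_if)
  qed
qed

text \<open>
  The factor \<open>2\<close> is for arguments of opposite sign: then both \<open>\<bar>x\<bar>\<close> and \<open>\<bar>y\<bar>\<close> are at most \<open>\<bar>x - y\<bar>\<close>.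
\<close>

lemma signed_powr_holder:
  assumes "0 < \<alpha>" "\<alpha> \<le> 1"
  shows "\<bar>signed_powr \<alpha> x - signed_powr \<alpha> y\<bar> \<le> 2 * \<bar>x - y\<bar> powr \<alpha>"
proof -
  have ge: "\<bar>s\<bar> powr \<alpha> \<le> \<bar>t\<bar> powr \<alpha> + \<bar>s - t\<bar> powr \<alpha>" for s t :: real
  proof -
    have "\<bar>s\<bar> powr \<alpha> \<le> (\<bar>t\<bar> + \<bar>s - t\<bar>) powr \<alpha>"
      using assms by (intro powr_mono2) auto
    also have "\<dots> \<le> \<bar>t\<bar> powr \<alpha> + \<bar>s - t\<bar> powr \<alpha>"
      using assms by (intro powr_subadditive) auto
    finally show ?thesis .
  qed
  have same: "\<bar>min 1 (\<bar>x\<bar> powr \<alpha>) - min 1 (\<bar>y\<bar> powr \<alpha>)\<bar> \<le> \<bar>x - y\<bar> powr \<alpha>"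
    using ge[of x y] ge[of y x] powr_ge_zero[of "\<bar>x-y\<bar>" \<alpha>] unfolding abs_minus_commute[of y x] by linarith
  show ?thesis
  proof (cases "x * y \<le> 0")
    case True
    have "\<bar>x\<bar> \<le> \<bar>x - y\<bar>" "\<bar>y\<bar> \<le> \<bar>x - y\<bar>" using True by (auto simp: mult_le_0_iff)
    then have "\<bar>x\<bar> powr \<alpha> \<le> \<bar>x - y\<bar> powr \<alpha>" "\<bar>y\<bar> powr \<alpha> \<le> \<bar>x - y\<bar> powr \<alpha>"
      using assms by (auto intro: powr_mono2)
    moreover have "\<bar>signed_powr \<alpha> t\<bar> \<le> \<bar>t\<bar> powr \<alpha>" for t
      by (auto simp: signed_powr_def abs_mult sgn_if)
    ultimately show ?thesis
      by (smt (verit, best))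
  next
    case False
    then have "sgn x = sgn y" "\<bar>sgn x\<bar> = 1" by (auto simp: sgn_if mult_le_0_iff)
    then have "\<bar>signed_powr \<alpha> x - signed_powr \<alpha> y\<bar> = \<bar>min 1 (\<bar>x\<bar> powr \<alpha>) - min 1 (\<bar>y\<bar> powr \<alpha>)\<bar>"
      unfolding signed_powr_def by (metis abs_mult mult.left_neutral right_diff_distrib)
    then show ?thesis using same powr_ge_zero[of "\<bar>x-y\<bar>" \<alpha>] by linarith
  qed
qed

text \<open>
  All summands of \<open>\<Sum>j. c\<^sub>j * signed_powr \<alpha> (x - q\<^sub>j)\<close> are nondecreasing. Hence no cancellation can
  destroy the infinite slope that the \<open>i\<close>-th one has at \<open>q\<^sub>i\<close>: an increment of the sum is at least the
  increment of the \<open>i\<close>-th summand. The weights sum to \<open>\<kappa>\<close>, which gives the other two bounds.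
\<close>

lemma ex_bounded_holder_steep_at_rationals:
  fixes \<alpha> \<kappa> :: real
  assumes \<alpha>: "0 < \<alpha>" "\<alpha> < 1" and \<kappa>: "0 < \<kappa>"
  obtains p :: "real \<Rightarrow> real" where
    "\<And>x. \<bar>p x\<bar> \<le> \<kappa>"
    "\<And>x y. \<bar>p x - p y\<bar> \<le> 2 * \<kappa> * \<bar>x - y\<bar> powr \<alpha>"
    "\<And>q M. q \<in> \<rat> \<Longrightarrow> \<exists>\<delta>>0. \<forall>x. \<bar>x - q\<bar> \<le> \<delta> \<longrightarrow> M * \<bar>x - q\<bar> \<le> \<bar>p x - p q\<bar> \<and> 0 \<le> (p x - p q) * (x - q)"
proof -
  define q :: "nat \<Rightarrow> real" where "q j = of_rat (from_nat j)" for j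
  define c :: "nat \<Rightarrow> real" where "c j = \<kappa> * (1/2) ^ Suc j" for j
  have c0: "c j > 0" for j using \<kappa> by (simp add: c_def)
  have csums: "c sums \<kappa>"
    using sums_mult[OF power_half_series, of \<kappa>] unfolding c_def by (simp only: mult_1_right)
  have csum: "summable c" "suminf c = \<kappa>" using csums by (auto simp: sums_iff)
  define f where "f x j = c j * signed_powr \<alpha> (x - q j)" for x j
  have nf: "norm (f x j) \<le> c j" for x j
    unfolding f_def using abs_signed_powr_le_1[of \<alpha> "x - q j"] c0[of j]
    by (simp add: abs_mult mult_left_le)
  have sf: "summable (f x)" for x
    by (rule summable_comparison_test'[OF csum(1)]) (use nf in auto)
  define p where "p x = suminf (f x)" for x
  have pd: "p x - p y = (\<Sum>j. f x j - f y j)" for x y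
    unfolding p_def by (rule suminf_diff[OF sf sf])
  have sfd: "summable (\<lambda>j. f x j - f y j)" for x y
    by (intro summable_diff sf)
  have bd: "\<bar>p x\<bar> \<le> \<kappa>" for x
    unfolding p_def real_norm_def[symmetric] csum(2)[symmetric]
    by (rule norm_suminf_le) (use nf csum in auto)
  have hold: "\<bar>p x - p y\<bar> \<le> 2 * \<kappa> * \<bar>x - y\<bar> powr \<alpha>" for x y
  proof -
    have "\<bar>f x j - f y j\<bar> \<le> c j * (2 * \<bar>x - y\<bar> powr \<alpha>)" for j
      unfolding f_def right_diff_distrib[symmetric] abs_mult
      using signed_powr_holder[of \<alpha> "x - q j" "y - q j"] \<alpha> c0[of j]
      by simp
    moreover have "summable (\<lambda>j. c j * (2 * \<bar>x - y\<bar> powr \<alpha>))"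
      by (intro summable_mult2 csum)
    ultimately have "norm (p x - p y) \<le> (\<Sum>j. c j * (2 * \<bar>x - y\<bar> powr \<alpha>))"
      unfolding pd by (intro norm_suminf_le) auto
    also have "\<dots> = \<kappa> * (2 * \<bar>x - y\<bar> powr \<alpha>)"
      using suminf_mult2[OF csum(1)] csum(2) by metis
    finally show ?thesis by simp
  qed
  have incr: "p x - p y \<ge> c i * (signed_powr \<alpha> (x - q i) - signed_powr \<alpha> (y - q i))" if "y \<le> x" for x y i
  proof -
    have "(\<Sum>j\<in>{i}. f x j - f y j) \<le> (\<Sum>j. f x j - f y j)"
    proof (rule sum_le_suminf[OF sfd])
      show "0 \<le> f x j - f y j" for j
        unfolding f_def right_diff_distrib[symmetric]
        using monoD[OF mono_signed_powr, of \<alpha> "y - q j" "x - q j"] \<alpha> c0[of j] that by simp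
    qed auto
    then show ?thesis unfolding pd by (simp add: f_def right_diff_distrib)
  qed
  show ?thesis
  proof (rule that[of p])
    fix r M :: real assume "r \<in> \<rat>"
    then obtain r' where "r = of_rat r'" by (auto simp: Rats_def)
    then have "r = q (to_nat r')" by (simp add: q_def)
    then obtain i where r: "r = q i" by blast
    \<comment> \<open>for small \<open>t > 0\<close>, \<open>M * t = M * t powr (1 - \<alpha>) * t powr \<alpha>\<close> is below \<open>c i * t powr \<alpha>\<close>\<close>
    have "((\<lambda>t::real. t powr (1 - \<alpha>)) \<longlongrightarrow> 0) (at_right 0)"
    proof -
      have "((\<lambda>t::real. t powr (1 - \<alpha>)) \<longlongrightarrow> 0 powr (1 - \<alpha>)) (at_right 0)"
        using \<alpha> by (intro tendsto_powr2 tendsto_intros) (auto simp: eventually_at_filter)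
      then show ?thesis using \<alpha> by simp
    qed
    then have "((\<lambda>t::real. max 0 M * t powr (1 - \<alpha>)) \<longlongrightarrow> max 0 M * 0) (at_right 0)"
      by (intro tendsto_intros)
    then have "\<forall>\<^sub>F t::real in at_right 0. max 0 M * t powr (1 - \<alpha>) < c i"
      using order_tendstoD(2)[of _ "max 0 M * 0" _ "c i"] c0[of i] by simp
    then obtain d where d: "d > 0" "\<And>t::real. 0 < t \<Longrightarrow> t < d \<Longrightarrow> max 0 M * t powr (1 - \<alpha>) < c i"
      by (auto simp: eventually_at_right_field)
    define \<delta> where "\<delta> = min (d/2) 1"
    have ge: "M * t \<le> c i * signed_powr \<alpha> t" if "0 \<le> t" "t \<le> \<delta>" for t
    proof (cases "t = 0")
      case False
      then have t: "0 < t" "t < d" "t \<le> 1" using that d(1) by (auto simp: \<delta>_def)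
      have "signed_powr \<alpha> t = t powr \<alpha>"
        using t powr_le1[of \<alpha> t] \<alpha> by (simp add: signed_powr_def)
      moreover have "max 0 M * t powr (1 - \<alpha>) * t powr \<alpha> \<le> c i * t powr \<alpha>"
        using d(2)[OF t(1,2)] by (intro mult_right_mono) auto
      moreover have "t powr (1 - \<alpha>) * t powr \<alpha> = t"
        using t by (simp flip: powr_add)
      ultimately have "max 0 M * t \<le> c i * signed_powr \<alpha> t" by (simp add: mult.assoc)
      moreover have "M * t \<le> max 0 M * t" using t by (intro mult_right_mono) auto
      ultimately show ?thesis by linarith
    qed simp
    show "\<exists>\<delta>>0. \<forall>x. \<bar>x - r\<bar> \<le> \<delta> \<longrightarrow> M * \<bar>x - r\<bar> \<le> \<bar>p x - p r\<bar> \<and> 0 \<le> (p x - p r) * (x - r)"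
    proof (intro exI[of _ \<delta>] conjI allI impI)
      show "\<delta> > 0" using d by (simp add: \<delta>_def)
    next
      fix x assume x: "\<bar>x - r\<bar> \<le> \<delta>"
      show "M * \<bar>x - r\<bar> \<le> \<bar>p x - p r\<bar>"
      proof (cases "r \<le> x")
        case True
        then show ?thesis using incr[OF True, of i] ge[of "x - r"] x by (simp add: r)
      next
        case False
        then show ?thesis using incr[of x r i] ge[of "r - x"] x signed_powr_minus[of \<alpha> "x - r"]
          by (simp add: r)
      qed
    next
      fix x assume x: "\<bar>x - r\<bar> \<le> \<delta>"
      have "p y \<le> p x" if "y \<le> x" for x y
        using incr[OF that, of 0] monoD[OF mono_signed_powr, of \<alpha> "y - q 0" "x - q 0"] \<alpha> c0[of 0] that
        by (smt (verit) mult_nonneg_nonneg)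
      from this[of r x] this[of x r] show "0 \<le> (p x - p r) * (x - r)"
        by (cases "r \<le> x") (auto intro: mult_nonneg_nonneg mult_nonpos_nonpos)
    qed
  qed (use bd hold in auto)
qed

text \<open>
  An antiderivative \<open>h\<close> of the function from the previous lemma: once its derivative increases with
  slope at least \<open>4\<close> around \<open>q\<close>, it lies above its tangent at \<open>q\<close> by at least \<open>2 (x - q)\<^sup>2\<close>. The
  constant \<open>2\<close> leaves room for absorbing a smooth term with second derivative at least \<open>-2\<close>.
\<close>

lemma ex_kinked_profile:
  fixes \<alpha> \<kappa> :: real
  assumes \<alpha>: "0 < \<alpha>" "\<alpha> < 1" and \<kappa>: "0 < \<kappa>"
  obtains h p :: "real \<Rightarrow> real" where
    "\<And>x. (h has_real_derivative p x) (at x)"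
    "h 0 = 0"
    "\<And>x. \<bar>p x\<bar> \<le> \<kappa>"
    "\<And>x y. \<bar>p x - p y\<bar> \<le> 2 * \<kappa> * \<bar>x - y\<bar> powr \<alpha>"
    "\<And>q. q \<in> \<rat> \<Longrightarrow> \<exists>\<delta>>0. \<forall>x. \<bar>x - q\<bar> \<le> \<delta> \<longrightarrow> h q + p q * (x - q) + 2 * (x - q)\<^sup>2 \<le> h x"
proof -
  obtain p :: "real \<Rightarrow> real" where p: "\<And>x. \<bar>p x\<bar> \<le> \<kappa>"
    "\<And>x y. \<bar>p x - p y\<bar> \<le> 2 * \<kappa> * \<bar>x - y\<bar> powr \<alpha>"
    "\<And>q M. q \<in> \<rat> \<Longrightarrow> \<exists>\<delta>>0. \<forall>x. \<bar>x - q\<bar> \<le> \<delta> \<longrightarrow> M * \<bar>x - q\<bar> \<le> \<bar>p x - p q\<bar> \<and> 0 \<le> (p x - p q) * (x - q)"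
    using ex_bounded_holder_steep_at_rationals[OF assms] by metis
  have "isCont p x" for x using isCont_if_holder[OF \<alpha>(1) p(2)] .
  then obtain H where H: "\<And>x. (H has_vector_derivative p x) (at x)"
    using einterval_antiderivative[of "-\<infinity>" "\<infinity>" p] by auto
  define h where "h x = H x - H 0" for x
  have h: "(h has_real_derivative p x) (at x)" for x
    unfolding h_def using H[of x]
    by (auto simp: has_real_derivative_iff_has_vector_derivative intro!: derivative_eq_intros)
  show ?thesis
  proof (rule that[of h p])
    fix q :: real assume "q \<in> \<rat>"
    then obtain \<delta> where \<delta>: "\<delta> > 0" "\<And>x. \<bar>x - q\<bar> \<le> \<delta> \<Longrightarrow> 4 * \<bar>x - q\<bar> \<le> \<bar>p x - p q\<bar> \<and> 0 \<le> (p x - p q) * (x - q)"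
      using p(3)[of q 4] by blast
    define F where "F x = h x - (h q + p q * (x - q) + 2 * (x - q)\<^sup>2)" for x
    have F: "(F has_real_derivative p x - p q - 4 * (x - q)) (at x)" for x
      unfolding F_def by (auto intro!: derivative_eq_intros h)
    have "F x \<ge> F q" if x: "\<bar>x - q\<bar> \<le> \<delta>" for x
    proof (cases "q \<le> x")
      case True
      show ?thesis
      proof (rule DERIV_nonneg_imp_nondecreasing[OF True])
        fix y assume y: "q \<le> y" "y \<le> x"
        have "4 * (y - q) \<le> p y - p q" if "y \<noteq> q"
          using \<delta>(2)[of y] x y that by (auto simp: zero_le_mult_iff)
        then show "\<exists>z. (F has_real_derivative z) (at y) \<and> z \<ge> 0"
          using F[of y] by (cases "y = q") fastforce+
      qed
    next
      case False
      then have "x \<le> q" by simp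
      then show ?thesis
      proof (rule DERIV_nonpos_imp_nonincreasing)
        fix y assume y: "x \<le> y" "y \<le> q"
        have "p y - p q \<le> 4 * (y - q)" if "y \<noteq> q"
          using \<delta>(2)[of y] x y that by (auto simp: zero_le_mult_iff)
        then show "\<exists>z. (F has_real_derivative z) (at y) \<and> z \<le> 0"
          using F[of y] by (cases "y = q") fastforce+
      qed
    qed
    then show "\<exists>\<delta>>0. \<forall>x. \<bar>x - q\<bar> \<le> \<delta> \<longrightarrow> h q + p q * (x - q) + 2 * (x - q)\<^sup>2 \<le> h x"
      using \<delta>(1) by (intro exI[of _ \<delta>]) (auto simp: F_def)
  qed (use h p in \<open>auto simp: h_def\<close>)
qed

section \<open>Plurisubharmonicity from affine minorants\<close>

lemma circle_mean_eq_integral: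
  assumes "continuous_on (sphere a r) f" "0 \<le> r"
  shows "circle_mean (\<lambda>\<zeta>. ereal (f \<zeta>)) a r
    = ereal (integral {0..2*pi} (\<lambda>t. f (a + of_real r * cis t)) / (2 * pi))"
proof -
  define F where "F t = f (a + of_real r * cis t)" for t
  define Fi where "Fi t = indicator {0..2*pi} t * F t" for t
  have cF: "continuous_on {0..2*pi} F" unfolding F_def
    by (rule continuous_on_compose2[OF assms(1)])
       (use assms in \<open>auto intro!: continuous_intros simp: dist_norm norm_mult\<close>)
  have "set_integrable lborel {0..2*pi} F" by (rule borel_integrable_atLeastAtMost'[OF cF])
  then have Fi: "integrable lborel Fi" and LI: "(\<integral>t. Fi t \<partial>lborel) = integral {0..2*pi} F"
    using set_borel_integral_eq_integral(2)[of "{0..2*pi}" F]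
    by (auto simp: set_integrable_def set_lebesgue_integral_def Fi_def[abs_def])
  have e: "e2ennreal (ereal x) = ennreal x" for x
    by (simp add: ennreal.abs_eq e2ennreal_def)
  have pos: "(\<integral>\<^sup>+t\<in>{0..2*pi}. e2ennreal (ereal (F t)) \<partial>lborel) = (\<integral>\<^sup>+t. ennreal (Fi t) \<partial>lborel)"
    by (intro nn_integral_cong) (auto simp: e Fi_def indicator_def)
  have neg: "(\<integral>\<^sup>+t\<in>{0..2*pi}. e2ennreal (- ereal (F t)) \<partial>lborel) = (\<integral>\<^sup>+t. ennreal (- Fi t) \<partial>lborel)"
    by (intro nn_integral_cong) (auto simp: e Fi_def indicator_def)
  have fin: "(\<integral>\<^sup>+t. ennreal (Fi t) \<partial>lborel) \<noteq> \<infinity>" "(\<integral>\<^sup>+t. ennreal (- Fi t) \<partial>lborel) \<noteq> \<infinity>"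
    using real_integrable_def[THEN iffD1, OF Fi] by auto
  have e2: "enn2ereal x = ereal (enn2real x)" if "x \<noteq> \<infinity>" for x
    using that by (cases x) auto
  show ?thesis
    unfolding circle_mean_def F_def[symmetric] pos neg e2[OF fin(1)] e2[OF fin(2)]
    using real_lebesgue_integral_def[OF Fi] LI by simp
qed

lemma usc_on_continuous:
  assumes "continuous_on S f"
  shows "usc_on S (\<lambda>x. ereal (f x))"
  unfolding usc_on_def
proof (intro ballI allI impI)
  fix x c assume "x \<in> S" "ereal (f x) < c"
  have "((\<lambda>x. ereal (f x)) \<longlongrightarrow> ereal (f x)) (at x within S)"
    using assms \<open>x \<in> S\<close> by (intro tendsto_ereal) (auto simp: continuous_on_def)
  from order_tendstoD(2)[OF this \<open>ereal (f x) < c\<close>]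
  show "\<forall>\<^sub>F y in at x within S. ereal (f y) < c" .
qed

text \<open>
  The inequality is required only along segments in \<open>D\<close>. On open convex sets this is convexity. The
  point of the weaker requirement is that it survives gluing: if \<open>f\<close> is convex and less than a
  constant \<open>c\<close> on a collar that separates two parts of \<open>D\<close>, then the function that is \<open>max c f\<close> on one
  part and \<open>c\<close> on the other still has it.
\<close>

definition supported_on :: "'a::real_inner set \<Rightarrow> ('a \<Rightarrow> real) \<Rightarrow> bool" where
  "supported_on D f \<longleftrightarrow>
     (\<forall>p\<in>D. \<exists>G. \<forall>q. closed_segment p q \<subseteq> D \<longrightarrow> f p + G \<bullet> (q - p) \<le> f q)"

lemma inner_scaled_unit_eq:
  fixes G b :: "complex ^ 'n"
  shows "G \<bullet> ((of_real r * cis t) *s b) = G \<bullet> (of_real r *s b) * cos t + G \<bullet> ((\<i> * of_real r) *s b) * sin t"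
proof -
  have "(of_real r * cis t) *s b = cos t *\<^sub>R (of_real r *s b) + sin t *\<^sub>R ((\<i> * of_real r) *s b)"
    by (simp add: vec_eq_iff complex_eq_iff algebra_simps)
  then show ?thesis by (simp add: inner_add_right)
qed

text \<open>
  A closed disc in the intersection of \<open>D\<close> with a complex line is convex, so the affine minorant at its
  centre is valid on the whole disc; averaged over the circle, its linear part \<open>A cos t + B sin t\<close>
  vanishes. Discs of all radii are covered at once: no passage from local to global submean
  inequalities is needed.
\<close>

lemma plurisubharmonic_on_supported:
  fixes f :: "complex ^ 'n \<Rightarrow> real"
  assumes cont: "continuous_on D f" and supp: "supported_on D f"
  shows "plurisubharmonic_on D (\<lambda>p. ereal (f p))"
  unfolding plurisubharmonic_on_def subharmonic_on_def
proof (intro conjI allI ballI impI)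
  show "usc_on D (\<lambda>p. ereal (f p))" by (rule usc_on_continuous[OF cont])
next
  fix a b :: "complex ^ 'n"
  define S where "S = {\<zeta>. a + \<zeta> *s b \<in> D}"
  have line: "continuous_on X (\<lambda>\<zeta>. a + \<zeta> *s b)" for X
    by (intro continuous_intros continuous_on_vec_lambda | simp add: vector_scalar_mult_def)+
  have contS: "continuous_on S (\<lambda>\<zeta>. f (a + \<zeta> *s b))"
    by (rule continuous_on_compose2[OF cont line]) (auto simp: S_def)
  show "usc_on {\<zeta>. a + \<zeta> *s b \<in> D} (\<lambda>\<zeta>. ereal (f (a + \<zeta> *s b)))"
    using usc_on_continuous[OF contS] by (simp add: S_def)
  fix z r assume "0 < r \<and> cball z r \<subseteq> {\<zeta>. a + \<zeta> *s b \<in> D}"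
  then have r: "0 < r" and disc: "cball z r \<subseteq> S" by (auto simp: S_def)
  have "z \<in> S" using r disc by auto
  then obtain G where G: "\<And>q. closed_segment (a + z *s b) q \<subseteq> D \<Longrightarrow>
      f (a + z *s b) + G \<bullet> (q - (a + z *s b)) \<le> f q"
    using supp unfolding supported_on_def S_def by blast
  define A B where "A = G \<bullet> (of_real r *s b)" and "B = G \<bullet> ((\<i> * of_real r) *s b)"
  define F where "F t = f (a + (z + of_real r * cis t) *s b)" for t
  have le: "f (a + z *s b) + (A * cos t + B * sin t) \<le> F t" for t
  proof -
    define w where "w = z + of_real r * cis t"
    have "w \<in> cball z r" using r by (simp add: w_def dist_norm norm_mult)
    then have "closed_segment z w \<subseteq> S"
      using disc closed_segment_subset[of z "cball z r" w] r by auto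
    moreover have "closed_segment (a + z *s b) (a + w *s b) = (\<lambda>\<zeta>. a + \<zeta> *s b) ` closed_segment z w"
      unfolding closed_segment_image_interval image_image
      by (intro image_cong) (auto simp: vec_eq_iff algebra_simps scaleR_conv_of_real[where 'a = complex])
    ultimately have "f (a + z *s b) + G \<bullet> ((a + w *s b) - (a + z *s b)) \<le> f (a + w *s b)"
      by (intro G) (auto simp: S_def)
    also have "(a + w *s b) - (a + z *s b) = (of_real r * cis t) *s b"
      by (simp add: w_def vec_eq_iff algebra_simps)
    finally show ?thesis unfolding inner_scaled_unit_eq by (simp add: F_def A_def B_def w_def)
  qed
  have circ: "continuous_on (sphere z r) (\<lambda>\<zeta>. f (a + \<zeta> *s b))"
    by (rule continuous_on_subset[OF contS]) (use disc in auto)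
  have Fint: "F integrable_on {0..2*pi}" unfolding F_def
    by (rule integrable_continuous_interval, rule continuous_on_compose2[OF circ])
       (use r in \<open>auto intro!: continuous_intros simp: dist_norm norm_mult\<close>)
  have "((\<lambda>t. f (a + z *s b) + (A * cos t + B * sin t)) has_integral
      (f (a + z *s b) * (2*pi) + (A * sin (2*pi) - B * cos (2*pi))) - (f (a + z *s b) * 0 + (A * sin 0 - B * cos 0))) {0..2*pi}"
    by (rule fundamental_theorem_of_calculus)
       (auto intro!: derivative_eq_intros simp flip: has_real_derivative_iff_has_vector_derivative)
  then have "2 * pi * f (a + z *s b) \<le> integral {0..2*pi} F"
    using has_integral_le[OF _ integrable_integral[OF Fint] le] by (simp add: mult.commute)
  then show "ereal (f (a + z *s b)) \<le> circle_mean (\<lambda>\<zeta>. ereal (f (a + \<zeta> *s b))) z r"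
    using circle_mean_eq_integral[OF circ] r unfolding F_def by (simp add: pos_le_divide_eq mult.commute)
qed auto

text \<open>
  The function \<open>t \<mapsto> - ln (- t)\<close> is convex and increasing for \<open>t < 0\<close>; its tangent at \<open>f p\<close>
  composed with the affine minorant of \<open>f\<close> at \<open>p\<close> is an affine minorant of the composition.
\<close>

lemma supported_on_ln:
  assumes "supported_on D f" "\<And>p. p \<in> D \<Longrightarrow> f p < 0"
  shows "supported_on D (\<lambda>p. - ln (- f p))"
  unfolding supported_on_def
proof
  fix p assume p: "p \<in> D"
  then obtain G where G: "\<And>q. closed_segment p q \<subseteq> D \<Longrightarrow> f p + G \<bullet> (q - p) \<le> f q"
    using assms(1) unfolding supported_on_def by blast
  have fp: "f p < 0" using assms(2) p .
  show "\<exists>G. \<forall>q. closed_segment p q \<subseteq> D \<longrightarrow> - ln (- f p) + G \<bullet> (q - p) \<le> - ln (- f q)"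
  proof (intro exI[of _ "(1 / - f p) *\<^sub>R G"] allI impI)
    fix q assume q: "closed_segment p q \<subseteq> D"
    then have fq: "f q < 0" using assms(2) by auto
    have "ln (- f q) - ln (- f p) = ln (f q / f p)"
      using fp fq ln_div[of "- f q" "- f p"] by simp
    also have "\<dots> \<le> f q / f p - 1" using fp fq by (intro ln_le_minus_one) (simp add: divide_neg_neg)
    also have "\<dots> = (f q - f p) / f p" using fp by (simp add: field_simps)
    also have "\<dots> \<le> (G \<bullet> (q - p)) / f p"
      using G[OF q] fp by (intro divide_right_mono_neg) auto
    finally show "- ln (- f p) + ((1 / - f p) *\<^sub>R G) \<bullet> (q - p) \<le> - ln (- f q)"
      by simp
  qed
qed

section \<open>Upper limits and touching discs\<close>

lemma le_Limsup_withinI: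
  fixes f :: "'a::metric_space \<Rightarrow> ereal"
  assumes "a \<notin> D" and "\<And>c d. c < L \<Longrightarrow> 0 < d \<Longrightarrow> \<exists>x\<in>D. dist x a < d \<and> c < f x"
  shows "L \<le> Limsup (at a within D) f"
proof (rule Limsup_greatest)
  fix P assume "eventually P (at a within D)"
  then obtain d where d: "d > 0" "\<And>x. x \<in> D \<Longrightarrow> x \<noteq> a \<Longrightarrow> dist x a < d \<Longrightarrow> P x"
    by (auto simp: eventually_at)
  show "L \<le> (SUP x\<in>Collect P. f x)"
  proof (rule dense_le)
    fix c assume "c < L"
    from assms(2)[OF this d(1)] obtain x where "x \<in> D" "dist x a < d" "c < f x" by blast
    then show "c \<le> (SUP x\<in>Collect P. f x)"
      using d(2)[of x] assms(1) by (intro SUP_upper2[of x]) auto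
  qed
qed

text \<open>
  A version of the continuity principle that only needs the centres of discs in parallel complex
  lines: by the submean inequality the values at the centres are bounded by the maximum on \<open>K\<close>, so an
  exhaustion function would keep the centres away from the boundary point \<open>c0\<close>.
\<close>

lemma not_pseudoconvex_if_touching_discs:
  fixes D :: "(complex ^ 'n) set" and c :: "nat \<Rightarrow> complex ^ 'n"
  assumes "0 < r" "compact K" "K \<subseteq> D"
    and disc: "\<And>n \<zeta>. norm \<zeta> \<le> r \<Longrightarrow> c n + \<zeta> *s b \<in> D"
    and circle: "\<And>n \<zeta>. norm \<zeta> = r \<Longrightarrow> c n + \<zeta> *s b \<in> K"
    and lim: "c \<longlonglongrightarrow> c0" "c0 \<notin> D"
  shows "\<not> pseudoconvex D"
proof
  assume "pseudoconvex D"
  then obtain \<phi> :: "complex ^ 'n \<Rightarrow> real" where \<phi>: "continuous_on D \<phi>"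
    "plurisubharmonic_on D (\<lambda>z. ereal (\<phi> z))"
    "\<And>m. closure {z\<in>D. \<phi> z < m} \<subseteq> D"
    unfolding pseudoconvex_def by blast
  have "bounded (\<phi> ` K)"
    using compact_continuous_image[OF continuous_on_subset[OF \<phi>(1) \<open>K \<subseteq> D\<close>] \<open>compact K\<close>]
    by (rule compact_imp_bounded)
  then obtain m where m: "\<And>z. z \<in> K \<Longrightarrow> \<phi> z \<le> m"
    by (auto simp: bounded_iff abs_le_iff)
  have "\<phi> (c n) \<le> m" for n
  proof -
    have cD: "c n + \<zeta> *s b \<in> D" if "norm \<zeta> \<le> r" for \<zeta> using disc[OF that] .
    have circ: "continuous_on (sphere 0 r) (\<lambda>\<zeta>. \<phi> (c n + \<zeta> *s b))"
    proof (rule continuous_on_compose2[OF \<phi>(1)])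
      show "continuous_on (sphere 0 r) (\<lambda>\<zeta>. c n + \<zeta> *s b)"
        by (intro continuous_intros continuous_on_vec_lambda | simp add: vector_scalar_mult_def)+
    qed (use cD in auto)
    have "ereal (\<phi> (c n)) \<le> circle_mean (\<lambda>\<zeta>. ereal (\<phi> (c n + \<zeta> *s b))) 0 r"
    proof -
      have "cball 0 r \<subseteq> {\<zeta>. c n + \<zeta> *s b \<in> D}" using cD by auto
      then have "ereal (\<phi> (c n + 0 *s b)) \<le> circle_mean (\<lambda>\<zeta>. ereal (\<phi> (c n + \<zeta> *s b))) 0 r"
        using \<phi>(2) \<open>0 < r\<close> unfolding plurisubharmonic_on_def subharmonic_on_def by blast
      then show ?thesis by simp
    qed
    then have "\<phi> (c n) \<le> integral {0..2*pi} (\<lambda>t. \<phi> (c n + (of_real r * cis t) *s b)) / (2*pi)"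
      using circle_mean_eq_integral[OF circ] \<open>0 < r\<close> by simp
    moreover have "integral {0..2*pi} (\<lambda>t. \<phi> (c n + (of_real r * cis t) *s b)) \<le> integral {0..2*pi} (\<lambda>t. m)"
    proof (rule integral_le)
      show "(\<lambda>t. \<phi> (c n + (of_real r * cis t) *s b)) integrable_on {0..2*pi}"
        by (rule integrable_continuous_interval, rule continuous_on_compose2[OF circ])
           (use \<open>0 < r\<close> in \<open>auto intro!: continuous_intros simp: norm_mult\<close>)
      show "\<phi> (c n + (of_real r * cis t) *s b) \<le> m" for t
        using \<open>0 < r\<close> by (intro m circle) (simp add: norm_mult)
    qed auto
    ultimately have "\<phi> (c n) \<le> integral {0..2*pi} (\<lambda>t. m) / (2*pi)"
      by (meson divide_right_mono order.trans pi_ge_zero zero_le_mult_iff zero_le_numeral)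
    then show ?thesis by simp
  qed
  moreover have "c n \<in> D" for n using disc[of 0 n] \<open>0 < r\<close> by simp
  ultimately have "c n \<in> {z\<in>D. \<phi> z < m + 1}" for n by (simp add: add.commute add_strict_increasing)
  then have "c0 \<in> closure {z\<in>D. \<phi> z < m + 1}"
    using lim(1) unfolding closure_sequential by blast
  then show False using \<phi>(3) lim(2) by blast
qed

section \<open>Suprema of locally finite families\<close>

lemma continuous_on_Max_atMost:
  fixes v :: "nat \<Rightarrow> 'a::topological_space \<Rightarrow> real"
  assumes "\<And>n. continuous_on S (v n)"
  shows "continuous_on S (\<lambda>x. Max ((\<lambda>n. v n x) ` {..N}))"
proof (induction N)
  case (Suc N)
  have "Max ((\<lambda>n. v n x) ` {..Suc N}) = max (v (Suc N) x) (Max ((\<lambda>n. v n x) ` {..N}))" for x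
    by (simp add: atMost_Suc)
  then show ?case using Suc assms by (simp add: continuous_on_max)
qed (simp add: assms)

text \<open>
  Local finiteness is what makes the supremum attained. This keeps it strictly below the common bound
  \<open>M\<close>, whereas infinitely many functions that come close to \<open>M\<close> could have supremum \<open>M\<close>.
\<close>

lemma supported_on_locally_finite_SUP:
  fixes v :: "nat \<Rightarrow> 'a::real_inner \<Rightarrow> real"
  assumes D: "open D"
    and cont: "\<And>n. continuous_on D (v n)" and supp: "\<And>n. supported_on D (v n)"
    and range: "\<And>n x. x \<in> D \<Longrightarrow> m \<le> v n x \<and> v n x < M"
    and fin: "\<And>x. x \<in> D \<Longrightarrow> \<exists>W N. open W \<and> x \<in> W \<and> (\<forall>y\<in>W \<inter> D. \<forall>n\<ge>N. v n y = m)"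
  defines "U \<equiv> \<lambda>x. SUP n. v n x"
  shows "continuous_on D U" "supported_on D U"
    "\<And>x n. x \<in> D \<Longrightarrow> v n x \<le> U x" "\<And>x. x \<in> D \<Longrightarrow> U x < M"
proof -
  have local_max: "U y = Max ((\<lambda>n. v n y) ` {..N})" if "\<And>n. n \<ge> N \<Longrightarrow> v n y = m" for y N
  proof -
    have "v n y \<in> (\<lambda>n. v n y) ` {..N}" for n
      using that[of n] that[of N] by (cases "n \<le> N") (auto intro: image_eqI[of _ _ N])
    then have "range (\<lambda>n. v n y) = (\<lambda>n. v n y) ` {..N}" by auto
    then show ?thesis by (simp add: U_def cSup_eq_Max)
  qed
  have attained: "\<exists>n. U x = v n x" if x: "x \<in> D" for x
  proof -
    obtain W N where "x \<in> W" "\<forall>y\<in>W \<inter> D. \<forall>n\<ge>N. v n y = m"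
      using fin[OF x] by blast
    then have "U x = Max ((\<lambda>n. v n x) ` {..N})" using x by (intro local_max) auto
    also have "\<dots> \<in> (\<lambda>n. v n x) ` {..N}" by (intro Max_in) auto
    finally show ?thesis by blast
  qed
  show ge: "v n x \<le> U x" if "x \<in> D" for x n
    unfolding U_def using range[OF that]
    by (intro cSUP_upper bdd_aboveI[of _ M]) (auto simp: less_imp_le)
  show "U x < M" if "x \<in> D" for x
    using attained[OF that] range[OF that] by auto
  show "supported_on D U"
    unfolding supported_on_def
  proof
    fix x assume x: "x \<in> D"
    obtain n where n: "U x = v n x" using attained[OF x] by blast
    obtain G where G: "\<And>y. closed_segment x y \<subseteq> D \<Longrightarrow> v n x + G \<bullet> (y - x) \<le> v n y"
      using supp[of n] x unfolding supported_on_def by blast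
    show "\<exists>G. \<forall>y. closed_segment x y \<subseteq> D \<longrightarrow> U x + G \<bullet> (y - x) \<le> U y"
    proof (intro exI[of _ G] allI impI)
      fix y assume y: "closed_segment x y \<subseteq> D"
      then have "y \<in> D" by auto
      with G[OF y] ge[of y n] n show "U x + G \<bullet> (y - x) \<le> U y" by linarith
    qed
  qed
  show "continuous_on D U"
  proof -
    have "isCont U x" if x: "x \<in> D" for x
    proof -
      obtain W N where W: "open W" "x \<in> W" "\<forall>y\<in>W \<inter> D. \<forall>n\<ge>N. v n y = m"
        using fin[OF x] by blast
      have "continuous_on (W \<inter> D) (\<lambda>y. Max ((\<lambda>n. v n y) ` {..N}))"
        by (intro continuous_on_Max_atMost continuous_on_subset[OF cont]) auto
      then have "continuous_on (W \<inter> D) U"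
        by (rule continuous_on_eq) (use W in \<open>auto intro!: local_max[symmetric]\<close>)
      then show ?thesis
        using W x D continuous_on_eq_continuous_at[of "W \<inter> D" U] by blast
    qed
    then show ?thesis by (simp add: continuous_at_imp_continuous_on)
  qed
qed

section \<open>Two complex coordinates\<close>

definition vec2 :: "complex \<Rightarrow> complex \<Rightarrow> complex ^ 2" where
  "vec2 z w = (\<chi> i. if i = 1 then z else w)"

lemma vec2_nth [simp]: "vec2 z w $ 1 = z" "vec2 z w $ 2 = w"
  by (simp_all add: vec2_def)

lemma vec2_eq_iff: "q = r \<longleftrightarrow> q $ 1 = r $ 1 \<and> q $ 2 = r $ 2" for q r :: "complex ^ 2"
  by (simp add: vec_eq_iff forall_2)

lemma continuous_on_vec2 [continuous_intros]:
  assumes "continuous_on S f" "continuous_on S f'"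
  shows "continuous_on S (\<lambda>x. vec2 (f x) (f' x))"
  unfolding vec2_def
proof (rule continuous_on_vec_lambda)
  show "continuous_on S (\<lambda>x. if i = 1 then f x else f' x)" for i :: 2
    using assms by (cases "i = 1") auto
qed

lemma inner_vec2: "q \<bullet> r = q $ 1 \<bullet> r $ 1 + q $ 2 \<bullet> r $ 2" for q r :: "complex ^ 2"
  by (simp add: inner_vec_def sum_2)

lemma norm_vec2_le: "norm q \<le> norm (q $ 1) + norm (q $ 2)" for q :: "complex ^ 2"
  using L2_set_le_sum[of UNIV "\<lambda>i. norm (q $ i)"] by (simp add: norm_vec_def sum_2)

lemma rational_complex_dense:
  assumes "open S" "z \<in> S"
  obtains z0 where "z0 \<in> S" "Re z0 \<in> \<rat>" "Im z0 \<in> \<rat>"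
proof -
  obtain e where e: "e > 0" "ball z e \<subseteq> S" using assms by (auto simp: open_contains_ball)
  obtain x where x: "x \<in> \<rat>" "Re z < x" "x < Re z + e / 2"
    using Rats_dense_in_real[of "Re z" "Re z + e / 2"] e by auto
  obtain y where y: "y \<in> \<rat>" "Im z < y" "y < Im z + e / 2"
    using Rats_dense_in_real[of "Im z" "Im z + e / 2"] e by auto
  have "dist z (Complex x y) < e"
    using cmod_le[of "z - Complex x y"] x y unfolding dist_norm by simp
  then show ?thesis using e x y by (intro that[of "Complex x y"]) auto
qed

section \<open>A domain with a kinked boundary\<close>

text \<open>
  The bound \<open>1 / 100\<close> only has to be small enough for \<open>\<bar>z\<bar>\<^sup>4 - \<bar>z\<bar>\<^sup>2\<close> to determine the shape of the
  function \<open>g\<close> below on scales comparable to \<open>1\<close>.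
\<close>

locale kinked_profile =
  fixes h p :: "real \<Rightarrow> real" and \<alpha> :: real
  assumes \<alpha>: "0 < \<alpha>" "\<alpha> < 1"
    and h_deriv: "\<And>x. (h has_real_derivative p x) (at x)"
    and h_0: "h 0 = 0"
    and p_bound: "\<And>x. \<bar>p x\<bar> \<le> 1 / 100"
    and p_holder: "\<And>x y. \<bar>p x - p y\<bar> \<le> 2 * (1 / 100) * \<bar>x - y\<bar> powr \<alpha>"
    and kink: "\<And>q. q \<in> \<rat> \<Longrightarrow> \<exists>\<delta>>0. \<forall>x. \<bar>x - q\<bar> \<le> \<delta> \<longrightarrow> h q + p q * (x - q) + 2 * (x - q)\<^sup>2 \<le> h x"
begin

definition g :: "complex \<Rightarrow> real" where
  "g z = (z \<bullet> z)\<^sup>2 - z \<bullet> z + h (Re z) + h (Im z)"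

text \<open>
  The gradient of \<open>g\<close>, for the identification of complex numbers with vectors in the plane.
\<close>

definition Dg :: "complex \<Rightarrow> complex" where
  "Dg z = of_real (4 * (z \<bullet> z) - 2) * z + Complex (p (Re z)) (p (Im z))"

definition \<rho> :: "complex ^ 2 \<Rightarrow> real" where
  "\<rho> q = q $ 2 \<bullet> q $ 2 + g (q $ 1) - 1"

definition D\<rho> :: "complex ^ 2 \<Rightarrow> complex ^ 2" where
  "D\<rho> q = vec2 (Dg (q $ 1)) (2 * q $ 2)"

definition D :: "(complex ^ 2) set" where
  "D = {q. \<rho> q < 0}"

lemma h_lipschitz: "\<bar>h x - h y\<bar> \<le> \<bar>x - y\<bar> / 100"
  using field_differentiable_bound[of UNIV h p "1/100" x y] h_deriv p_bound by auto

lemma h_coords_lipschitz: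
  "\<bar>h (Re z) + h (Im z) - (h (Re w) + h (Im w))\<bar> \<le> norm (z - w) / 50"
  using h_lipschitz[of "Re z" "Re w"] h_lipschitz[of "Im z" "Im w"]
    abs_Re_le_cmod[of "z - w"] abs_Im_le_cmod[of "z - w"]
    abs_diff_triangle_ineq[of "h (Re z)" "h (Im z)" "h (Re w)" "h (Im w)"]
  unfolding minus_complex.sel by linarith

lemma h_coords_bound: "\<bar>h (Re z) + h (Im z)\<bar> \<le> norm z / 50"
  using h_coords_lipschitz[of z 0] by (simp add: h_0)

lemma g_deriv: "(g has_derivative (\<lambda>d. d \<bullet> Dg z)) (at z)"
proof -
  have h': "(h has_derivative (\<lambda>d. d * p x)) (at x within X)" for x X
    using h_deriv[of x] unfolding has_field_derivative_def
    by (auto intro!: has_derivative_at_withinI simp: mult_commute_abs)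
  have Re': "((\<lambda>z. h (Re z)) has_derivative (\<lambda>d. Re d * p (Re z))) (at z)"
    by (rule has_derivative_compose[OF has_derivative_Re[OF has_derivative_ident] h'])
  have Im': "((\<lambda>z. h (Im z)) has_derivative (\<lambda>d. Im d * p (Im z))) (at z)"
    by (rule has_derivative_compose[OF has_derivative_Im[OF has_derivative_ident] h'])
  show ?thesis
    unfolding g_def[abs_def]
    by (rule has_derivative_eq_rhs, (rule derivative_intros Re' Im')+)
       (auto simp: fun_eq_iff Dg_def inner_complex_def power2_eq_square algebra_simps)
qed

lemma continuous_on_g: "continuous_on S g"
  using g_deriv by (meson continuous_at_imp_continuous_on has_derivative_continuous)

lemma continuous_on_\<rho>: "continuous_on S \<rho>"
  unfolding \<rho>_def[abs_def] by (intro continuous_intros continuous_on_compose2[OF continuous_on_g[of UNIV]]) auto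

lemma \<rho>_deriv: "GDERIV \<rho> q :> D\<rho> q"
proof -
  have 1: "((\<lambda>q. g (q $ 1)) has_derivative (\<lambda>d. d $ 1 \<bullet> Dg (q $ 1))) (at q)"
    by (rule has_derivative_compose[OF bounded_linear_imp_has_derivative[OF bounded_linear_vec_nth] g_deriv])
  have 2: "((\<lambda>q. q $ 2) has_derivative (\<lambda>d. d $ 2)) (at q)"
    by (rule bounded_linear_imp_has_derivative[OF bounded_linear_vec_nth])
  show ?thesis
    unfolding gderiv_def \<rho>_def[abs_def]
    by (rule has_derivative_eq_rhs, (rule derivative_intros 1 2)+)
       (auto simp: fun_eq_iff D\<rho>_def inner_vec2 inner_complex_def algebra_simps)
qed

lemma open_D: "open D"
  unfolding D_def using continuous_on_\<rho>[of UNIV]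
  by (simp add: open_Collect_less)

lemma g_small: "norm z \<le> 1 \<Longrightarrow> g z \<le> 1 / 50"
proof -
  assume z: "norm z \<le> 1"
  have "z \<bullet> z \<le> 1" using z by (simp add: dot_square_norm power_le_one)
  then have "(z \<bullet> z) * (z \<bullet> z) \<le> 1 * (z \<bullet> z)" by (intro mult_right_mono) auto
  then show ?thesis
    using h_coords_bound[of z] z unfolding g_def power2_eq_square mult_1 by linarith
qed

text \<open>
  The sublevel set is starlike: inside the unit disc \<open>g\<close> is too small to reach \<open>1\<close>, and outside of it
  \<open>\<bar>z\<bar>\<^sup>4 - \<bar>z\<bar>\<^sup>2\<close> increases along rays at a rate that \<open>h\<close> cannot compensate.
\<close>

lemma g_less_1_scaleR:
  assumes "0 \<le> t" "t \<le> 1" "g z < 1"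
  shows "g (t *\<^sub>R z) < 1"
proof -
  define r where "r = norm z"
  have *: "g (t *\<^sub>R z) \<le> g z" if "1 \<le> norm (t *\<^sub>R z)"
  proof -
    have tr: "1 \<le> t * r" using that assms by (simp add: r_def)
    have "t * r \<le> r" using assms by (simp add: r_def mult_left_le_one_le)
    then have r: "1 \<le> r" using tr by linarith
    have tr2: "1 \<le> (t * r)\<^sup>2" "1 \<le> r\<^sup>2" using tr r by (simp_all add: one_le_power)
    have zz: "z \<bullet> z = r\<^sup>2" "(t *\<^sub>R z) \<bullet> (t *\<^sub>R z) = (t * r)\<^sup>2"
      by (auto simp: r_def dot_square_norm power_mult_distrib power2_eq_square)
    have "norm (z - t *\<^sub>R z) = (1 - t) * r"
      using assms norm_scaleR[of "1 - t" z] by (simp add: r_def scaleR_left_diff_distrib)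
    then have "\<bar>h (Re z) + h (Im z) - (h (Re (t *\<^sub>R z)) + h (Im (t *\<^sub>R z)))\<bar> \<le> (1 - t) * r / 50"
      using h_coords_lipschitz[of z "t *\<^sub>R z"] by simp
    moreover have "(1 - t) * r \<le> ((r\<^sup>2)\<^sup>2 - r\<^sup>2) - (((t*r)\<^sup>2)\<^sup>2 - (t*r)\<^sup>2)"
    proof -
      have "(1 - t) * r * 1 \<le> (1 - t) * r * (r * (1 + t))"
        using assms r tr by (intro mult_left_mono) (auto simp: algebra_simps)
      also have "\<dots> = (r\<^sup>2 - (t*r)\<^sup>2) * 1" by (simp add: power2_eq_square algebra_simps)
      also have "\<dots> \<le> (r\<^sup>2 - (t*r)\<^sup>2) * (r\<^sup>2 + (t*r)\<^sup>2 - 1)"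
        using tr2 power_mono[of "t * r" r 2] \<open>t * r \<le> r\<close> tr by (intro mult_left_mono) linarith+
      also have "\<dots> = ((r\<^sup>2)\<^sup>2 - r\<^sup>2) - (((t*r)\<^sup>2)\<^sup>2 - (t*r)\<^sup>2)"
        by (simp add: power2_eq_square algebra_simps)
      finally show ?thesis by simp
    qed
    moreover have "0 \<le> (1 - t) * r" using assms r by simp
    ultimately show ?thesis unfolding g_def zz by linarith
  qed
  show "g (t *\<^sub>R z) < 1"
    using *[THEN order.strict_trans1[OF _ assms(3)]] g_small[of "t *\<^sub>R z"]
    by linarith
qed

lemma vec2_in_D_iff: "vec2 z w \<in> D \<longleftrightarrow> w \<bullet> w < 1 - g z"
  by (auto simp: D_def \<rho>_def)

lemma D_iff: "q \<in> D \<longleftrightarrow> q $ 2 \<bullet> q $ 2 < 1 - g (q $ 1)"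
  by (auto simp: D_def \<rho>_def)

lemma g_less_1_if_D: "q \<in> D \<Longrightarrow> g (q $ 1) < 1"
  using inner_ge_zero[of "q $ 2"] unfolding D_iff by linarith

text \<open>
  Each point can be joined to the origin by first shrinking \<open>w\<close> to \<open>0\<close> and then shrinking \<open>z\<close>. The
  order matters: where \<open>g\<close> is negative, \<open>\<bar>w\<bar>\<close> may exceed \<open>1\<close>, and then shrinking \<open>z\<close> leads out of \<open>D\<close>.
\<close>

lemma domain_D: "domain D"
proof -
  define path where "path q = closed_segment q (vec2 (q $ 1) 0) \<union> closed_segment (vec2 (q $ 1) 0) 0"
    for q :: "complex ^ 2"
  have sub: "path q \<subseteq> D" if q: "q \<in> D" for q
  proof -
    have "(1 - t) *\<^sub>R q + t *\<^sub>R vec2 (q $ 1) 0 \<in> D" if t: "0 \<le> t" "t \<le> 1" for t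
    proof -
      have "(1 - t) *\<^sub>R q + t *\<^sub>R vec2 (q $ 1) 0 = vec2 (q $ 1) ((1 - t) *\<^sub>R q $ 2)"
        by (simp add: vec2_eq_iff flip: scaleR_left_distrib)
      moreover have "((1 - t) *\<^sub>R q $ 2) \<bullet> ((1 - t) *\<^sub>R q $ 2) \<le> q $ 2 \<bullet> q $ 2"
        using t unfolding dot_square_norm by (intro power_mono) (auto intro: mult_left_le_one_le)
      ultimately show ?thesis using q unfolding D_iff by simp
    qed
    moreover have "(1 - t) *\<^sub>R vec2 (q $ 1) 0 + t *\<^sub>R 0 \<in> D" if t: "0 \<le> t" "t \<le> 1" for t
      using g_less_1_scaleR[of "1 - t" "q $ 1"] g_less_1_if_D[OF q] t unfolding D_iff by simp
    ultimately show ?thesis by (auto simp: path_def closed_segment_def)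
  qed
  have "(0::complex ^ 2) \<in> D" by (simp add: D_iff g_def h_0)
  moreover have "D = \<Union> (path ` D)"
    using sub by (fastforce simp: path_def)
  moreover have "connected (\<Union> (path ` D))"
  proof (rule connected_Union)
    show "connected s" if "s \<in> path ` D" for s
      using that by (auto simp: path_def intro!: connected_Un)
    have "0 \<in> \<Inter> (path ` D)" by (auto simp: path_def)
    then show "\<Inter> (path ` D) \<noteq> {}" by blast
  qed
  ultimately show ?thesis unfolding domain_def using open_D by auto
qed

lemma bounded_D: "bounded D"
proof (rule boundedI)
  fix q assume q: "q \<in> D"
  define r s where "r = norm (q $ 1)" and "s = norm (q $ 2)"
  have rs: "0 \<le> r" "0 \<le> s" by (auto simp: r_def s_def)
  have "s\<^sup>2 + ((r\<^sup>2)\<^sup>2 - r\<^sup>2) < 1 + r / 50"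
    using q h_coords_bound[of "q $ 1"] unfolding D_iff g_def r_def s_def dot_square_norm by linarith
  moreover have "0 \<le> (r\<^sup>2 - 1)\<^sup>2" by simp
  ultimately have rs2: "s\<^sup>2 + r\<^sup>2 < 2 + r / 50"
    unfolding power2_diff by simp
  have "r < 3"
  proof (rule ccontr)
    assume "\<not> r < 3"
    then have "3 * r \<le> r\<^sup>2" unfolding power2_eq_square by (intro mult_right_mono) auto
    then show False using rs2 zero_le_power2[of s] \<open>\<not> r < 3\<close> by linarith
  qed
  moreover have "s < 3"
  proof (rule ccontr)
    assume "\<not> s < 3"
    then have "3 * 3 \<le> s * s" by (intro mult_mono) auto
    then show False using rs2 zero_le_power2[of r] \<open>r < 3\<close> unfolding power2_eq_square by linarith
  qed
  ultimately show "norm q \<le> 6" using norm_vec2_le[of q] by (simp add: r_def s_def)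
qed

lemma continuous_on_Dg: "continuous_on S Dg"
proof -
  have "isCont p x" for x using isCont_if_holder[OF \<alpha>(1) p_holder] .
  then have p: "continuous_on UNIV p" by (simp add: continuous_at_imp_continuous_on)
  have "Complex (p (Re z)) (p (Im z)) = of_real (p (Re z)) + \<i> * of_real (p (Im z))" for z
    by (simp add: complex_eq_iff)
  then show ?thesis
    unfolding Dg_def[abs_def]
    by (auto intro!: continuous_intros continuous_on_compose2[OF p])
qed

text \<open>
  Critical points of \<open>\<rho>\<close> have \<open>w = 0\<close> and \<open>\<bar>z\<bar> \<le> 1\<close>, because \<open>\<bar>z\<bar>\<^sup>4 - \<bar>z\<bar>\<^sup>2\<close> is steep outside the unit
  disc; there \<open>\<rho>\<close> is close to \<open>-1\<close> or below. So they do not lie on the boundary.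
\<close>

lemma D\<rho>_eq_0_imp: "D\<rho> q = 0 \<Longrightarrow> \<rho> q < 0"
proof -
  assume *: "D\<rho> q = 0"
  define z where "z = q $ 1"
  have w: "q $ 2 = 0" and z0: "Dg z = 0" using * by (auto simp: D\<rho>_def vec2_eq_iff z_def)
  have "norm z \<le> 1"
  proof (rule ccontr)
    assume "\<not> norm z \<le> 1"
    then have z1: "1 < norm z" by simp
    then have zz: "1 < z \<bullet> z" unfolding dot_square_norm by (simp add: one_less_power)
    have "norm (of_real (4 * (z \<bullet> z) - 2) * z) = norm (Complex (p (Re z)) (p (Im z)))"
      using z0 unfolding Dg_def by (metis add_eq_0_iff norm_minus_cancel)
    also have "\<dots> \<le> 1 / 50"
      using cmod_le[of "Complex (p (Re z)) (p (Im z))"] p_bound[of "Re z"] p_bound[of "Im z"] by simp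
    finally have "\<bar>4 * (z \<bullet> z) - 2\<bar> * norm z \<le> 1 / 50" by (simp only: norm_mult norm_of_real)
    moreover have "2 * 1 \<le> \<bar>4 * (z \<bullet> z) - 2\<bar> * norm z" using zz z1 by (intro mult_mono) auto
    ultimately show False by simp
  qed
  then show ?thesis using g_small[of z] w by (simp add: \<rho>_def z_def)
qed

lemma p_coords_holder:
  "norm (Complex (p (Re a)) (p (Im a)) - Complex (p (Re b)) (p (Im b))) \<le> norm (a - b) powr \<alpha>"
proof -
  have "\<bar>p x - p y\<bar> \<le> norm (a - b) powr \<alpha> / 50" if "\<bar>x - y\<bar> \<le> norm (a - b)" for x y
    using p_holder[of x y] powr_mono2[of \<alpha> "\<bar>x - y\<bar>" "norm (a - b)"] that \<alpha> by simp
  from this[of "Re a" "Re b"] this[of "Im a" "Im b"]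
  have "\<bar>p (Re a) - p (Re b)\<bar> + \<bar>p (Im a) - p (Im b)\<bar> \<le> norm (a - b) powr \<alpha>"
    using abs_Re_le_cmod[of "a - b"] abs_Im_le_cmod[of "a - b"] powr_ge_zero[of "norm (a - b)" \<alpha>]
    unfolding minus_complex.sel by linarith
  then show ?thesis
    using cmod_le[of "Complex (p (Re a)) (p (Im a)) - Complex (p (Re b)) (p (Im b))"]
    by simp
qed

text \<open>
  On a bounded set the polynomial part of the gradient is Lipschitz, and distances there are bounded by
  a multiple of their \<open>\<alpha>\<close>-th power; only the terms from \<open>p\<close> are genuinely Hoelder.
\<close>

lemma D\<rho>_holder: "holder_on \<alpha> (ball c 1) D\<rho>"
proof -
  define R where "R = norm c + 1"
  have "R \<ge> 1" by (simp add: R_def)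
  have cube: "norm (of_real (4 * (a \<bullet> a) - 2) * a - of_real (4 * (b \<bullet> b) - 2) * b) \<le> (12 * R\<^sup>2 + 2) * norm (a - b)"
    if "norm a \<le> R" "norm b \<le> R" for a b :: complex
  proof -
    have "of_real (4 * (a \<bullet> a) - 2) * a - of_real (4 * (b \<bullet> b) - 2) * b
        = of_real (4 * (a \<bullet> a) - 2) * (a - b) + of_real (4 * ((norm a)\<^sup>2 - (norm b)\<^sup>2)) * b"
      by (simp add: algebra_simps flip: dot_square_norm)
    also have "norm \<dots> \<le> \<bar>4 * (a \<bullet> a) - 2\<bar> * norm (a - b) + \<bar>4 * ((norm a)\<^sup>2 - (norm b)\<^sup>2)\<bar> * norm b"
      by (intro order.trans[OF norm_triangle_ineq]) (simp add: norm_mult del: of_real_mult of_real_diff of_real_power)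
    also have "\<dots> \<le> (4 * R\<^sup>2 + 2) * norm (a - b) + (8 * R * norm (a - b)) * R"
    proof (intro add_mono mult_mono)
      show "\<bar>4 * (a \<bullet> a) - 2\<bar> \<le> 4 * R\<^sup>2 + 2"
        using power_mono[OF that(1) norm_ge_zero, of 2] zero_le_power2[of "norm a"]
        unfolding dot_square_norm by linarith
      have "\<bar>(norm a)\<^sup>2 - (norm b)\<^sup>2\<bar> = (norm a + norm b) * \<bar>norm a - norm b\<bar>"
        unfolding power2_eq_square square_diff_square_factored abs_mult by simp
      also have "\<dots> \<le> (2 * R) * norm (a - b)"
        using that norm_triangle_ineq3[of a b] \<open>R \<ge> 1\<close> by (intro mult_mono) auto
      finally show "\<bar>4 * ((norm a)\<^sup>2 - (norm b)\<^sup>2)\<bar> \<le> 8 * R * norm (a - b)"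
        by (simp add: abs_mult)
    qed (use that \<open>R \<ge> 1\<close> in auto)
    finally show ?thesis by (simp add: power2_eq_square algebra_simps)
  qed
  have "dist (D\<rho> x) (D\<rho> y) \<le> (2 * (12 * R\<^sup>2 + 4) + 1) * dist x y powr \<alpha>"
    if x: "x \<in> ball c 1" and y: "y \<in> ball c 1" for x y
  proof -
    define d where "d = dist x y"
    have "d \<le> dist x c + dist c y" unfolding d_def by (rule dist_triangle)
    also have "\<dots> \<le> 2" using x y by (simp add: dist_commute)
    finally have d: "0 \<le> d" "d \<le> 2" by (auto simp: d_def)
    have nx: "norm x \<le> R" and ny: "norm y \<le> R"
      using norm_triangle_sub[of x c] norm_triangle_sub[of y c] x y
      by (auto simp: R_def dist_norm norm_minus_commute)
    have comp: "norm (x $ i - y $ i) \<le> d" for i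
      using Finite_Cartesian_Product.norm_nth_le[of "x - y" i] by (simp add: d_def dist_norm)
    have split: "dist (D\<rho> x) (D\<rho> y) \<le> norm (Dg (x $ 1) - Dg (y $ 1)) + norm (2 * x $ 2 - 2 * y $ 2)"
      using norm_vec2_le[of "D\<rho> x - D\<rho> y"] by (simp add: dist_norm D\<rho>_def)
    have "norm (Dg (x $ 1) - Dg (y $ 1)) \<le> (12 * R\<^sup>2 + 2) * norm (x $ 1 - y $ 1) + norm (x $ 1 - y $ 1) powr \<alpha>"
      unfolding Dg_def add_diff_add
      by (intro order.trans[OF norm_triangle_ineq] add_mono cube p_coords_holder
          order.trans[OF Finite_Cartesian_Product.norm_nth_le] nx ny)
    also have "\<dots> \<le> (12 * R\<^sup>2 + 2) * d + d powr \<alpha>"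
      using comp[of 1] \<alpha> by (intro add_mono mult_left_mono powr_mono2) auto
    finally have first: "norm (Dg (x $ 1) - Dg (y $ 1)) \<le> (12 * R\<^sup>2 + 2) * d + d powr \<alpha>" .
    have second: "norm (2 * x $ 2 - 2 * y $ 2) \<le> 2 * d"
      using comp[of 2] norm_mult[of 2 "x $ 2 - y $ 2"] by (simp add: right_diff_distrib)
    have "d \<le> 2 * d powr \<alpha>"
    proof (cases "d = 0")
      case False
      have "d = d powr (1 - \<alpha>) * d powr \<alpha>" using d False by (simp flip: powr_add)
      also have "\<dots> \<le> 2 powr 1 * d powr \<alpha>"
        using d \<alpha> order.trans[OF powr_mono2[of "1 - \<alpha>" d 2] powr_mono[of "1 - \<alpha>" 1 2]]
        by (intro mult_right_mono) auto
      finally show ?thesis by simp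
    qed simp
    then have "(12 * R\<^sup>2 + 4) * d \<le> (12 * R\<^sup>2 + 4) * (2 * d powr \<alpha>)"
      by (intro mult_left_mono) auto
    then have "dist (D\<rho> x) (D\<rho> y) \<le> (12 * R\<^sup>2 + 4) * (2 * d powr \<alpha>) + d powr \<alpha>"
      using split first second by (simp add: algebra_simps)
    then show ?thesis by (simp add: d_def algebra_simps)
  qed
  then show ?thesis unfolding holder_on_def by blast
qed

lemma C1_holder_boundary_D: "C1_holder_boundary \<alpha> D"
  unfolding C1_holder_boundary_def
proof
  fix a assume a: "a \<in> frontier D"
  then have "a \<notin> D" using open_D by (simp add: frontier_def interior_open)
  then have "D\<rho> a \<noteq> 0" using D\<rho>_eq_0_imp by (auto simp: D_def)
  define U where "U = ball a 1 \<inter> {q. D\<rho> q \<noteq> 0}"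
  have "continuous_on UNIV D\<rho>"
    unfolding D\<rho>_def[abs_def]
    by (intro continuous_intros continuous_on_compose2[OF continuous_on_Dg[of UNIV]]) auto
  then have "open {q. D\<rho> q \<noteq> 0}"
    by (intro open_Collect_neq continuous_on_const)
  then have "open U" unfolding U_def by blast
  moreover have "holder_on \<alpha> U D\<rho>"
    using D\<rho>_holder[of a] unfolding holder_on_def U_def by blast
  moreover have "D \<inter> U = {q \<in> U. \<rho> q < 0}" by (auto simp: D_def)
  moreover have "a \<in> U" using \<open>D\<rho> a \<noteq> 0\<close> by (simp add: U_def)
  ultimately show "\<exists>U \<rho> g. open U \<and> a \<in> U \<and> (\<forall>z\<in>U. (GDERIV \<rho> z :> g z) \<and> g z \<noteq> 0) \<and>
      holder_on \<alpha> U g \<and> D \<inter> U = {z \<in> U. \<rho> z < 0}"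
    using \<rho>_deriv by (intro exI[of _ U] exI[of _ \<rho>] exI[of _ D\<rho>]) (auto simp: U_def)
qed

section \<open>Failure of pseudoconvexity\<close>

text \<open>
  A maximum point \<open>z0\<close> of \<open>g\<close> on the disc of radius \<open>1 / 2\<close> must be close to \<open>0\<close>, as \<open>g\<close> is negative on
  \<open>1 / 24 < \<bar>z\<bar> \<le> 1 / 2\<close> and \<open>g 0 = 0\<close>. Hence the circle of radius \<open>1 / 4\<close> around \<open>z0\<close> lies in the region
  where \<open>g < 0\<close>. The discs over it at height \<open>s * w\<close> with \<open>w\<^sup>2 = 1 - g z0\<close> and \<open>s < 1\<close> lie in \<open>D\<close>, and
  as \<open>s\<close> tends to \<open>1\<close> their centres tend to a boundary point but their boundary circles do not.
\<close>

lemma not_pseudoconvex_D: "\<not> pseudoconvex D"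
proof -
  obtain z0 where z0: "norm z0 \<le> 1 / 2" and max: "\<And>z. norm z \<le> 1 / 2 \<Longrightarrow> g z \<le> g z0"
  proof -
    have "cball (0::complex) (1/2) \<noteq> {}" by simp
    from continuous_attains_sup[OF compact_cball this continuous_on_g]
    obtain x where "x \<in> cball 0 (1/2)" "\<forall>y\<in>cball 0 (1/2). g y \<le> g x" by blast
    then show ?thesis by (intro that[of x]) auto
  qed
  have upper: "g z \<le> norm z * (1 / 50 - 3 / 4 * norm z)" if "norm z \<le> 1 / 2" for z
  proof -
    have "(norm z)\<^sup>2 \<le> (1 / 2)\<^sup>2" using that by (intro power_mono) auto
    then have "(norm z)\<^sup>2 * (norm z)\<^sup>2 \<le> (1 / 4) * (norm z)\<^sup>2"
      by (intro mult_right_mono) (auto simp: power2_eq_square)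
    moreover have "norm z * (1 / 50 - 3 / 4 * norm z) = norm z / 50 - 3 / 4 * (norm z)\<^sup>2"
      by (simp add: power2_eq_square algebra_simps)
    ultimately show ?thesis using h_coords_bound[of z]
      unfolding g_def dot_square_norm power2_eq_square[of "(norm z)\<^sup>2"] by linarith
  qed
  have g0: "0 \<le> g z0" using max[of 0] by (simp add: g_def h_0)
  have z0_small: "norm z0 \<le> 1 / 24"
  proof (rule ccontr)
    assume *: "\<not> norm z0 \<le> 1 / 24"
    then have "norm z0 * (1 / 50 - 3 / 4 * norm z0) < 0" by (intro mult_pos_neg) auto
    then show False using upper[OF z0] g0 by linarith
  qed
  have disc_in: "norm (z0 + \<zeta>) \<le> 1 / 2" if "norm \<zeta> \<le> 1 / 4" for \<zeta>
    using norm_triangle_ineq[of z0 \<zeta>] that z0_small by linarith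
  have neg: "g (z0 + \<zeta>) < 0" if "norm \<zeta> = 1 / 4" for \<zeta>
  proof -
    have "1 / 8 \<le> norm (z0 + \<zeta>)" using norm_diff_ineq[of \<zeta> z0] that z0_small by (simp add: add.commute)
    then have "norm (z0 + \<zeta>) * (1 / 50 - 3 / 4 * norm (z0 + \<zeta>)) < 0" by (intro mult_pos_neg) linarith+
    then show ?thesis using upper[OF disc_in, of \<zeta>] that by linarith
  qed
  have g1: "g z0 < 1" using g_small[of z0] z0 by simp
  define w where "w = sqrt (1 - g z0)"
  have w: "w > 0" "w * w = 1 - g z0" using g1 by (auto simp: w_def)
  define K where "K = (\<lambda>(\<zeta>, s). vec2 (z0 + \<zeta>) (of_real (s * w))) ` (sphere 0 (1/4) \<times> {0..1})"
  define c where "c n = vec2 z0 (of_real (real n / real (Suc n) * w))" for n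
  have inner_real: "(of_real x :: complex) \<bullet> of_real x = x * x" for x
    by (simp add: inner_complex_def)
  have line: "c n + \<zeta> *s vec2 1 0 = vec2 (z0 + \<zeta>) (of_real (real n / real (Suc n) * w))" for n \<zeta>
    by (simp add: c_def vec2_eq_iff)
  have sq: "s * w * (s * w) \<le> s * (1 - g z0)" if "0 \<le> s" "s \<le> 1" for s
  proof -
    have "s * w * (s * w) = s * (s * (1 - g z0))" by (simp flip: w(2))
    also have "\<dots> \<le> s * (1 * (1 - g z0))" using that g1 by (intro mult_left_mono mult_right_mono) auto
    finally show ?thesis by simp
  qed
  show ?thesis
  proof (rule not_pseudoconvex_if_touching_discs[of "1/4" K D c "vec2 1 0" "vec2 z0 (of_real w)"])
    show "compact K" unfolding K_def
      by (intro compact_continuous_image compact_Times compact_sphere compact_Icc)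
         (auto simp: case_prod_unfold intro!: continuous_intros)
    show "K \<subseteq> D"
    proof
      fix q assume "q \<in> K"
      then obtain \<zeta> s where q: "q = vec2 (z0 + \<zeta>) (of_real (s * w))" "norm \<zeta> = 1 / 4" "0 \<le> s" "s \<le> 1"
        by (auto simp: K_def)
      have "s * (1 - g z0) \<le> 1 * (1 - g z0)" using q g1 by (intro mult_right_mono) auto
      with sq[OF q(3,4)] have "s * w * (s * w) \<le> 1 * (1 - g z0)" by (rule order.trans)
      then show "q \<in> D" using neg[OF q(2)] g0
        unfolding q(1) vec2_in_D_iff inner_real by simp
    qed
    show "c n + \<zeta> *s vec2 1 0 \<in> D" if "norm \<zeta> \<le> 1 / 4" for n \<zeta>
    proof -
      have s: "0 \<le> real n / real (Suc n)" "real n / real (Suc n) < 1" by auto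
      have "real n / real (Suc n) * (1 - g z0) < 1 * (1 - g z0)"
        using s g1 by (intro mult_strict_right_mono) auto
      with sq[OF s(1) less_imp_le[OF s(2)]]
      have "real n / real (Suc n) * w * (real n / real (Suc n) * w) < 1 * (1 - g z0)"
        by (rule order.strict_trans1)
      then show ?thesis using max[OF disc_in[OF that]]
        unfolding line vec2_in_D_iff inner_real by simp
    qed
    show "c n + \<zeta> *s vec2 1 0 \<in> K" if "norm \<zeta> = 1 / 4" for n \<zeta>
      unfolding line K_def using that
      by (intro image_eqI[of _ _ "(\<zeta>, real n / real (Suc n))"]) auto
    show "c \<longlonglongrightarrow> vec2 z0 (of_real w)"
    proof -
      have "continuous_on UNIV (\<lambda>s. vec2 z0 (of_real (s * w)))"
        by (intro continuous_intros)
      then have "isCont (\<lambda>s. vec2 z0 (of_real (s * w))) 1"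
        by (simp add: continuous_on_eq_continuous_at)
      from isCont_tendsto_compose[OF this LIMSEQ_n_over_Suc_n]
      show ?thesis by (simp add: c_def[abs_def])
    qed
    show "vec2 z0 (of_real w) \<notin> D" unfolding vec2_in_D_iff inner_real w(2) by simp
  qed simp
qed

section \<open>Barriers at a dense set of boundary points\<close>

text \<open>
  Of the \<open>2 \<bar>z - z0\<bar>\<^sup>2\<close> gained from the kinks of \<open>h\<close>, one half compensates the concave term \<open>- \<bar>z\<bar>\<^sup>2\<close>
  of \<open>g\<close>; the term \<open>\<bar>z\<bar>\<^sup>4\<close> is convex.
\<close>

lemma g_kink:
  assumes "Re z0 \<in> \<rat>" "Im z0 \<in> \<rat>"
  obtains \<delta> where "\<delta> > 0"
    "\<And>z. norm (z - z0) \<le> \<delta> \<Longrightarrow> g z0 + Dg z0 \<bullet> (z - z0) + (norm (z - z0))\<^sup>2 \<le> g z"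
proof -
  obtain a where a: "a > 0" "\<And>x. \<bar>x - Re z0\<bar> \<le> a \<Longrightarrow>
      h (Re z0) + p (Re z0) * (x - Re z0) + 2 * (x - Re z0)\<^sup>2 \<le> h x"
    using kink[OF assms(1)] by blast
  obtain b where b: "b > 0" "\<And>x. \<bar>x - Im z0\<bar> \<le> b \<Longrightarrow>
      h (Im z0) + p (Im z0) * (x - Im z0) + 2 * (x - Im z0)\<^sup>2 \<le> h x"
    using kink[OF assms(2)] by blast
  show ?thesis
  proof (rule that[of "min a b"])
    fix z assume z: "norm (z - z0) \<le> min a b"
    have "\<bar>Re z - Re z0\<bar> \<le> a" "\<bar>Im z - Im z0\<bar> \<le> b"
      using z abs_Re_le_cmod[of "z - z0"] abs_Im_le_cmod[of "z - z0"] by auto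
    note ab = a(2)[OF this(1)] b(2)[OF this(2)]
    define d where "d = z - z0"
    have z_eq: "z = z0 + d" by (simp add: d_def)
    have nd: "(norm d)\<^sup>2 = (Re d)\<^sup>2 + (Im d)\<^sup>2" by (simp add: cmod_power2)
    have zz: "z \<bullet> z = z0 \<bullet> z0 + 2 * (z0 \<bullet> d) + (norm d)\<^sup>2"
      unfolding z_eq by (simp add: inner_add_left inner_add_right inner_commute flip: dot_square_norm)
    have "(z \<bullet> z)\<^sup>2 = (z0 \<bullet> z0)\<^sup>2 + 2 * (z0 \<bullet> z0) * (2 * (z0 \<bullet> d) + (norm d)\<^sup>2) + (2 * (z0 \<bullet> d) + (norm d)\<^sup>2)\<^sup>2"
      unfolding zz by (simp add: power2_eq_square algebra_simps)
    moreover have "0 \<le> 2 * (z0 \<bullet> z0) * (norm d)\<^sup>2" by simp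
    ultimately have "(z \<bullet> z)\<^sup>2 \<ge> (z0 \<bullet> z0)\<^sup>2 + 4 * (z0 \<bullet> z0) * (z0 \<bullet> d)"
      by (simp add: distrib_left)
    moreover have "Dg z0 \<bullet> d = 4 * (z0 \<bullet> z0) * (z0 \<bullet> d) - 2 * (z0 \<bullet> d) + p (Re z0) * Re d + p (Im z0) * Im d"
      unfolding Dg_def inner_complex_def by (simp add: algebra_simps)
    ultimately show "g z0 + Dg z0 \<bullet> (z - z0) + (norm (z - z0))\<^sup>2 \<le> g z"
      using ab unfolding d_def[symmetric] g_def zz nd minus_complex.sel[symmetric] by linarith
  qed (use a b in auto)
qed

text \<open>
  With \<open>P\<close> as below, \<open>g_kink\<close> says \<open>P + \<bar>z - z0\<bar>\<^sup>2 \<le> \<rho> < 0\<close> on the part of \<open>D\<close> over the disc of radius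
  \<open>\<delta>\<close> around \<open>z0\<close>. Hence \<open>P < - s\<^sup>2 = - \<gamma>\<close> where \<open>s \<le> \<bar>z - z0\<bar> \<le> \<delta>\<close>, so that \<open>max (-1) (P / \<gamma>)\<close>
  is \<open>-1\<close> in a collar and can be continued by \<open>-1\<close>; it exceeds \<open>-1\<close> only where \<open>\<rho> > - \<gamma>\<close>.
\<close>

lemma barrier:
  assumes rat: "Re z0 \<in> \<rat>" "Im z0 \<in> \<rat>" and \<eta>: "\<eta> > 0"
  obtains v where "continuous_on D v" "supported_on D v"
    "\<And>q. q \<in> D \<Longrightarrow> -1 \<le> v q \<and> v q < 0"
    "\<And>q. q \<in> D \<Longrightarrow> \<rho> q \<le> -\<eta> \<Longrightarrow> v q = -1"
    "\<And>(w::complex) c d. w \<bullet> w = 1 - g z0 \<Longrightarrow> g z0 < 1 \<Longrightarrow> c < 0 \<Longrightarrow> d > 0 \<Longrightarrow>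
       \<exists>q\<in>D. dist q (vec2 z0 w) < d \<and> c < v q"
proof -
  obtain \<delta> where \<delta>: "\<delta> > 0"
    and below: "\<And>z. norm (z - z0) \<le> \<delta> \<Longrightarrow> g z0 + Dg z0 \<bullet> (z - z0) + (norm (z - z0))\<^sup>2 \<le> g z"
    using g_kink[OF rat] by blast
  define P where "P q = q $ 2 \<bullet> q $ 2 + g z0 + Dg z0 \<bullet> (q $ 1 - z0) - 1" for q :: "complex ^ 2"
  define s where "s = min (\<delta> / 2) (min 1 \<eta>)"
  have s: "0 < s" "s < \<delta>" "s \<le> 1" "s \<le> \<eta>" using \<delta> \<eta> by (auto simp: s_def)
  define \<gamma> where "\<gamma> = s\<^sup>2"
  have \<gamma>: "0 < \<gamma>" "\<gamma> \<le> \<eta>"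
    using s power_decreasing[of 1 2 s] by (auto simp: \<gamma>_def)
  have P_le: "P q + (norm (q $ 1 - z0))\<^sup>2 \<le> \<rho> q" if "norm (q $ 1 - z0) \<le> \<delta>" for q
    using below[OF that] by (simp add: P_def \<rho>_def)
  have contP: "continuous_on X P" for X
    unfolding P_def[abs_def] by (intro continuous_intros)
  define v where "v q = (if norm (q $ 1 - z0) < s then max (-1) (P q / \<gamma>) else -1)" for q
  have v_near: "v q = max (-1) (P q / \<gamma>)" if "q \<in> D" "norm (q $ 1 - z0) \<le> \<delta>" for q
  proof (cases "norm (q $ 1 - z0) < s")
    case False
    then have "\<gamma> \<le> (norm (q $ 1 - z0))\<^sup>2" using s by (simp add: \<gamma>_def power_mono)
    then have "P q \<le> -\<gamma>" using P_le[OF that(2)] that(1) by (simp add: D_def)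
    then have "P q / \<gamma> \<le> -1" using \<gamma> by (simp add: divide_le_eq)
    then show ?thesis using False by (simp add: v_def)
  qed (simp add: v_def)
  have v_range: "-1 \<le> v q \<and> v q < 0" if q: "q \<in> D" for q
  proof (cases "norm (q $ 1 - z0) < s")
    case True
    then have "P q + (norm (q $ 1 - z0))\<^sup>2 < 0" using P_le[of q] q s by (simp add: D_def)
    then have "P q < 0" using zero_le_power2[of "norm (q $ 1 - z0)"] by linarith
    then show ?thesis using \<gamma> True by (simp add: v_def divide_neg_pos)
  qed (simp add: v_def)
  show ?thesis
  proof (rule that[of v])
    have "continuous_on (D \<inter> {q. norm (q $ 1 - z0) < \<delta>}) v"
      by (rule continuous_on_eq[where f = "\<lambda>q. max (-1) (P q / \<gamma>)"])
         (use \<gamma> in \<open>auto simp: v_near intro!: continuous_intros contP\<close>)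
    moreover have "continuous_on (D \<inter> {q. s < norm (q $ 1 - z0)}) v"
      by (rule continuous_on_eq[where f = "\<lambda>_. -1"]) (auto simp: v_def)
    moreover have "open (D \<inter> {q. norm (q $ 1 - z0) < \<delta>})" "open (D \<inter> {q. s < norm (q $ 1 - z0)})"
      by (intro open_Int open_D open_Collect_less continuous_intros)+
    moreover have "D = (D \<inter> {q. norm (q $ 1 - z0) < \<delta>}) \<union> (D \<inter> {q. s < norm (q $ 1 - z0)})"
      using s by auto
    ultimately show "continuous_on D v" by (metis continuous_on_open_Un)
  next
    show "supported_on D v"
      unfolding supported_on_def
    proof
      fix x assume x: "x \<in> D"
      show "\<exists>G. \<forall>y. closed_segment x y \<subseteq> D \<longrightarrow> v x + G \<bullet> (y - x) \<le> v y"
      proof (cases "v x = -1")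
        case True
        then show ?thesis using v_range by (intro exI[of _ 0]) auto
      next
        case False
        then have near: "norm (x $ 1 - z0) < s" by (auto simp: v_def split: if_splits)
        with False have vx: "v x = P x / \<gamma>" and "-1 < P x / \<gamma>" by (auto simp: v_def max_def split: if_splits)
        define G where "G = (1 / \<gamma>) *\<^sub>R vec2 (Dg z0) (2 * x $ 2)"
        define l where "l y = v x + G \<bullet> (y - x)" for y
        have l_le: "l y \<le> P y / \<gamma>" for y
        proof -
          have "0 \<le> (y $ 2 - x $ 2) \<bullet> (y $ 2 - x $ 2)" by simp
          then have "P x + vec2 (Dg z0) (2 * x $ 2) \<bullet> (y - x) \<le> P y"
            unfolding P_def inner_vec2 by (simp add: inner_complex_def algebra_simps)
          then have "(P x + vec2 (Dg z0) (2 * x $ 2) \<bullet> (y - x)) / \<gamma> \<le> P y / \<gamma>"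
            using \<gamma> by (intro divide_right_mono) auto
          then show ?thesis by (simp add: l_def G_def vx add_divide_distrib)
        qed
        \<comment> \<open>A segment on which the minorant \<open>l\<close> exceeds the value \<open>-1\<close> at its far end \<open>y\<close> has \<open>l > -1\<close>
          throughout, hence \<open>P / \<gamma> > -1\<close>, and so it cannot cross the collar.\<close>
        have "l y \<le> v y" if seg: "closed_segment x y \<subseteq> D" for y
        proof (rule ccontr)
          assume "\<not> l y \<le> v y"
          then have "v y < l y" by simp
          have "y \<in> D" using seg by auto
          then have "-1 < l y" using v_range \<open>v y < l y\<close> by force
          have "\<not> norm (y $ 1 - z0) < s"
            using \<open>v y < l y\<close> l_le[of y] by (auto simp: v_def)
          then have "s \<in> {norm (x $ 1 - z0)..norm (y $ 1 - z0)}" using near by simp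
          moreover have "continuous_on (closed_segment x y) (\<lambda>q. norm (q $ 1 - z0))"
            by (intro continuous_intros)
          then have "connected ((\<lambda>q. norm (q $ 1 - z0)) ` closed_segment x y)"
            by (intro connected_continuous_image) auto
          then have "{norm (x $ 1 - z0)..norm (y $ 1 - z0)} \<subseteq> (\<lambda>q. norm (q $ 1 - z0)) ` closed_segment x y"
            by (rule connected_contains_Icc) auto
          ultimately have "s \<in> (\<lambda>q. norm (q $ 1 - z0)) ` closed_segment x y"
            by (rule rev_subsetD)
          then obtain q where q: "q \<in> closed_segment x y" "norm (q $ 1 - z0) = s" by blast
          then obtain t where t: "0 \<le> t" "t \<le> 1" "q = (1 - t) *\<^sub>R x + t *\<^sub>R y"
            by (auto simp: closed_segment_def)
          have "q - x = t *\<^sub>R (y - x)" unfolding t(3) by (simp add: algebra_simps)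
          then have "l q = v x + t * (G \<bullet> (y - x))" by (simp add: l_def)
          then have "l q = (1 - t) * l x + t * l y" by (simp add: l_def algebra_simps)
          moreover have "-1 < l x" using vx \<open>-1 < P x / \<gamma>\<close> by (simp add: l_def)
          ultimately have "-1 < l q"
            using convex_bound_lt[of "- l x" 1 "- l y" "1 - t" t] t \<open>-1 < l y\<close> by simp
          then have "-1 < P q / \<gamma>" using l_le[of q] by simp
          then have "-\<gamma> < P q" using \<gamma> by (simp add: less_divide_eq)
          moreover have "q \<in> D" using q seg by auto
          ultimately show False using P_le[of q] q(2) s by (simp add: D_def \<gamma>_def)
        qed
        then show ?thesis by (auto simp: l_def)
      qed
    qed
  next
    fix q assume q: "q \<in> D" "\<rho> q \<le> -\<eta>"
    show "v q = -1"
    proof (cases "norm (q $ 1 - z0) < s")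
      case True
      then have "P q \<le> -\<gamma>" using P_le[of q] q s \<gamma> zero_le_power2[of "norm (q $ 1 - z0)"]
        by linarith
      then have "P q / \<gamma> \<le> -1" using \<gamma> by (simp add: divide_le_eq)
      then show ?thesis by (simp add: v_def)
    qed (simp add: v_def)
  next
    fix w :: complex and c d :: real
    assume w: "w \<bullet> w = 1 - g z0" and g1: "g z0 < 1" and c: "c < 0" and d: "d > 0"
    \<comment> \<open>approach the boundary point along a ray in the \<open>w\<close>-direction, where \<open>P\<close> and \<open>\<rho>\<close> agree\<close>
    define Q where "Q t = vec2 z0 (of_real t * w)" for t
    have P_Q: "P (Q t) = (t\<^sup>2 - 1) * (1 - g z0)" for t
    proof -
      have "(of_real t * w) \<bullet> (of_real t * w) = t\<^sup>2 * (w \<bullet> w)"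
        by (simp add: dot_square_norm norm_mult power_mult_distrib)
      then show ?thesis by (simp add: P_def Q_def w algebra_simps)
    qed
    have "continuous_on UNIV (\<lambda>t. dist (Q t) (vec2 z0 w))" "continuous_on UNIV (\<lambda>t. P (Q t) / \<gamma>)"
      unfolding P_Q unfolding Q_def using \<gamma> by (auto intro!: continuous_intros)
    then have "isCont (\<lambda>t. dist (Q t) (vec2 z0 w)) 1" "isCont (\<lambda>t. P (Q t) / \<gamma>) 1"
      by (simp_all add: continuous_on_eq_continuous_at)
    moreover have at_1: "dist (Q 1) (vec2 z0 w) = 0" "P (Q 1) / \<gamma> = 0"
      unfolding P_Q by (simp_all add: Q_def)
    ultimately have "((\<lambda>t. dist (Q t) (vec2 z0 w)) \<longlongrightarrow> 0) (at_left 1)" "((\<lambda>t. P (Q t) / \<gamma>) \<longlongrightarrow> 0) (at_left 1)"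
      unfolding isCont_def filterlim_at_split at_1 by blast+
    then have "\<forall>\<^sub>F t in at_left 1. dist (Q t) (vec2 z0 w) < d \<and> c < P (Q t) / \<gamma>"
      using d c by (intro eventually_conj order_tendstoD) auto
    moreover have "\<forall>\<^sub>F t::real in at_left 1. 0 < t \<and> t < 1"
      by (auto simp: eventually_at_left_field intro!: exI[of _ 0])
    ultimately have "\<forall>\<^sub>F t in at_left 1. (dist (Q t) (vec2 z0 w) < d \<and> c < P (Q t) / \<gamma>) \<and> (0 < t \<and> t < 1)"
      by (rule eventually_conj)
    then obtain t where t: "dist (Q t) (vec2 z0 w) < d" "c < P (Q t) / \<gamma>" "0 < t" "t < 1"
      using eventually_happens[of _ "at_left (1::real)"] trivial_limit_at_left_real by blast
    have "\<rho> (Q t) = P (Q t)" by (simp add: \<rho>_def P_def Q_def)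
    also have "\<dots> < 0" unfolding P_Q using t g1 by (intro mult_neg_pos) (auto simp: power_less_one_iff)
    finally have "Q t \<in> D" by (simp add: D_def)
    moreover have "c < v (Q t)" using t(2) s by (simp add: v_def Q_def)
    ultimately show "\<exists>q\<in>D. dist q (vec2 z0 w) < d \<and> c < v q" using t(1) by blast
  qed (use v_range in auto)
qed

text \<open>
  Near a boundary point \<open>(z, w)\<close> the boundary contains the graph of \<open>\<psi>\<close>, which keeps the argument of
  \<open>w\<close>, over the part of a neighbourhood of \<open>z\<close> in which \<open>g < 1\<close>. This part is open and nonempty,
  also if \<open>w = 0\<close>, because points of \<open>D\<close> project into it.
\<close>

lemma peaks_dense_in_frontier:
  assumes a: "a \<in> frontier D" and d: "d > 0"
  obtains z0 w where "Re z0 \<in> \<rat>" "Im z0 \<in> \<rat>" "g z0 < 1" "w \<bullet> w = 1 - g z0"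
    "dist (vec2 z0 w) a < d"
proof -
  have "a \<notin> D" "a \<in> closure D" using a open_D by (auto simp: frontier_def interior_open)
  have "D \<subseteq> {q. \<rho> q \<le> 0}" "closed {q. \<rho> q \<le> 0}"
    using continuous_on_\<rho> by (auto simp: D_def intro!: closed_Collect_le continuous_intros)
  then have "\<rho> a \<le> 0" using \<open>a \<in> closure D\<close> closure_minimal[of D] by blast
  then have "\<rho> a = 0" using \<open>a \<notin> D\<close> by (simp add: D_def)
  then have w2: "(norm (a $ 2))\<^sup>2 = 1 - g (a $ 1)" by (simp add: \<rho>_def dot_square_norm)
  \<comment> \<open>if \<open>w = 0\<close>, any unit vector will do\<close>
  define e where "e = (if a $ 2 = 0 then 1 else sgn (a $ 2))"
  have e: "norm e = 1" "a $ 2 = of_real (norm (a $ 2)) * e"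
    by (simp add: e_def norm_sgn) (simp add: e_def sgn_eq)
  define \<psi> where "\<psi> z = of_real (sqrt (1 - g z)) * e" for z
  have \<psi>: "\<psi> z \<bullet> \<psi> z = 1 - g z" if "g z < 1" for z
    using that e(1) by (simp add: \<psi>_def dot_square_norm norm_mult)
  have "\<psi> (a $ 1) = a $ 2"
    using e(2) unfolding \<psi>_def w2[symmetric] by simp
  then have a_eq: "vec2 (a $ 1) (\<psi> (a $ 1)) = a" by (simp add: vec2_eq_iff)
  define S where "S = {z. dist (vec2 z (\<psi> z)) a < d} \<inter> {z. g z < 1}"
  have cont: "continuous_on UNIV (\<lambda>z. dist (vec2 z (\<psi> z)) a)"
    unfolding \<psi>_def by (intro continuous_intros continuous_on_g)
  then have "open S" unfolding S_def
    by (intro open_Int open_Collect_less continuous_on_g continuous_on_const)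
  have "open {q::complex ^ 2. dist (vec2 (q $ 1) (\<psi> (q $ 1))) a < d}"
    by (intro open_Collect_less continuous_on_const continuous_on_compose2[OF cont] continuous_intros) auto
  moreover have "a \<in> {q. dist (vec2 (q $ 1) (\<psi> (q $ 1))) a < d}" using a_eq d by simp
  ultimately obtain q where "q \<in> D" "dist (vec2 (q $ 1) (\<psi> (q $ 1))) a < d"
    using \<open>a \<in> closure D\<close> unfolding closure_iff_nhds_not_empty by blast
  then have "q $ 1 \<in> S" using g_less_1_if_D by (simp add: S_def)
  from rational_complex_dense[OF \<open>open S\<close> this]
  obtain z0 where "z0 \<in> S" "Re z0 \<in> \<rat>" "Im z0 \<in> \<rat>" by blast
  then show ?thesis using \<psi>[of z0] by (intro that[of z0 "\<psi> z0"]) (auto simp: S_def)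
qed

text \<open>
  The \<open>n\<close>-th barrier is made to exceed \<open>-1\<close> only where \<open>\<rho> > - 1 / (n + 1)\<close>, so that only
  finitely many of them matter near a given point of \<open>D\<close>.
\<close>

lemma ex_supported_exhaustion:
  obtains U where "continuous_on D U" "supported_on D U" "\<And>q. q \<in> D \<Longrightarrow> U q < 0"
    "\<And>a c d. a \<in> frontier D \<Longrightarrow> c < 0 \<Longrightarrow> d > 0 \<Longrightarrow> \<exists>q\<in>D. dist q a < d \<and> c < U q"
proof -
  define pt where "pt n = (case from_nat n :: rat \<times> rat of (x, y) \<Rightarrow> Complex (of_rat x) (of_rat y))" for n
  have pt_rat: "Re (pt n) \<in> \<rat>" "Im (pt n) \<in> \<rat>" for n
    by (auto simp: pt_def split: prod.split)
  have pt_surj: "\<exists>n. pt n = z" if z: "Re z \<in> \<rat>" "Im z \<in> \<rat>" for z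
  proof -
    obtain x where "Re z = of_rat x" using z(1) by (rule Rats_cases)
    moreover obtain y where "Im z = of_rat y" using z(2) by (rule Rats_cases)
    ultimately have "pt (to_nat (x, y)) = z" by (simp add: pt_def complex_eq_iff)
    then show ?thesis by blast
  qed
  have "\<exists>v. continuous_on D v \<and> supported_on D v \<and> (\<forall>q\<in>D. -1 \<le> v q \<and> v q < 0) \<and>
      (\<forall>q\<in>D. \<rho> q \<le> - (1 / real (Suc n)) \<longrightarrow> v q = -1) \<and>
      (\<forall>(w::complex) c d. w \<bullet> w = 1 - g (pt n) \<longrightarrow> g (pt n) < 1 \<longrightarrow> c < 0 \<longrightarrow> d > 0 \<longrightarrow>
         (\<exists>q\<in>D. dist q (vec2 (pt n) w) < d \<and> c < v q))" for n
    by (rule barrier[OF pt_rat[of n], of "1 / real (Suc n)"]) (simp, blast)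
  then obtain v where v: "\<And>n. continuous_on D (v n)" "\<And>n. supported_on D (v n)"
    "\<And>n q. q \<in> D \<Longrightarrow> -1 \<le> v n q \<and> v n q < 0"
    "\<And>n q. q \<in> D \<Longrightarrow> \<rho> q \<le> - (1 / real (Suc n)) \<Longrightarrow> v n q = -1"
    "\<And>n (w::complex) c d. w \<bullet> w = 1 - g (pt n) \<Longrightarrow> g (pt n) < 1 \<Longrightarrow> c < 0 \<Longrightarrow> d > 0 \<Longrightarrow>
         (\<exists>q\<in>D. dist q (vec2 (pt n) w) < d \<and> c < v n q)"
    by metis
  have fin: "\<exists>W N. open W \<and> x \<in> W \<and> (\<forall>y\<in>W \<inter> D. \<forall>n\<ge>N. v n y = -1)" if x: "x \<in> D" for x
  proof -
    have "0 < - \<rho> x" using x by (simp add: D_def)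
    then obtain N where N: "1 / real (Suc N) < - \<rho> x" using nat_approx_posE by blast
    have "v n y = -1" if "y \<in> D" "\<rho> y < - (1 / real (Suc N))" "n \<ge> N" for n y
    proof (rule v(4)[OF that(1)])
      have "1 / real (Suc n) \<le> 1 / real (Suc N)" using that(3) by (simp add: field_simps)
      then show "\<rho> y \<le> - (1 / real (Suc n))" using that(2) by linarith
    qed
    moreover have "open {y. \<rho> y < - (1 / real (Suc N))}"
      by (intro open_Collect_less continuous_on_\<rho> continuous_on_const)
    ultimately show ?thesis using N
      by (intro exI[of _ "{y. \<rho> y < - (1 / real (Suc N))}"] exI[of _ N]) auto
  qed
  have U: "continuous_on D (\<lambda>x. SUP n. v n x)" "supported_on D (\<lambda>x. SUP n. v n x)"
    "\<And>x n. x \<in> D \<Longrightarrow> v n x \<le> (SUP n. v n x)" "\<And>x. x \<in> D \<Longrightarrow> (SUP n. v n x) < 0"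
    using supported_on_locally_finite_SUP[where m = "-1" and M = 0, OF open_D v(1,2,3) fin] by blast+
  show ?thesis
  proof (rule that[of "\<lambda>x. SUP n. v n x"])
    fix a c d assume a: "a \<in> frontier D" and c: "c < (0::real)" and d: "d > (0::real)"
    obtain z0 w where zw: "Re z0 \<in> \<rat>" "Im z0 \<in> \<rat>" "g z0 < 1" "w \<bullet> w = 1 - g z0" "dist (vec2 z0 w) a < d / 2"
      using peaks_dense_in_frontier[OF a, of "d / 2"] d by auto
    obtain n where n: "z0 = pt n" using pt_surj[OF zw(1,2)] by blast
    obtain q where q: "q \<in> D" "dist q (vec2 z0 w) < d / 2" "c < v n q"
      using v(5)[of w n c "d / 2"] zw c d unfolding n by auto
    have "dist q a < d" using dist_triangle[of q a "vec2 z0 w"] q zw by linarith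
    moreover have "c < (SUP n. v n q)" using U(3)[OF q(1), of n] q(3) by linarith
    ultimately show "\<exists>q\<in>D. dist q a < d \<and> c < (SUP n. v n q)" using q(1) by blast
  qed (use U in auto)
qed

end

section \<open>The counterexample\<close>

theorem theorem1:
  fixes \<epsilon> :: real
  assumes "0 < \<epsilon>" and "\<epsilon> < 1"
  shows "\<exists>(D :: (complex ^ 2) set) (u :: complex ^ 2 \<Rightarrow> ereal).
           domain D \<and> bounded D \<and> \<not> pseudoconvex D \<and>
           C1_holder_boundary (1 - \<epsilon>) D \<and>
           plurisubharmonic_on D u \<and> (\<forall>z\<in>D. u z < 0) \<and>
           (\<forall>a\<in>frontier D. Limsup (at a within D) u = 0) \<and>
           plurisubharmonic_on D (\<lambda>z. - log_ereal (- u z)) \<and>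
           (\<forall>a\<in>frontier D. Limsup (at a within D) (\<lambda>z. - log_ereal (- u z)) = \<infinity>)"
proof -
  have \<alpha>: "0 < 1 - \<epsilon>" "1 - \<epsilon> < 1" using assms by auto
  obtain h p :: "real \<Rightarrow> real" where hp:
    "\<And>x. (h has_real_derivative p x) (at x)" "h 0 = 0" "\<And>x. \<bar>p x\<bar> \<le> 1 / 100"
    "\<And>x y. \<bar>p x - p y\<bar> \<le> 2 * (1 / 100) * \<bar>x - y\<bar> powr (1 - \<epsilon>)"
    "\<And>q. q \<in> \<rat> \<Longrightarrow> \<exists>\<delta>>0. \<forall>x. \<bar>x - q\<bar> \<le> \<delta> \<longrightarrow> h q + p q * (x - q) + 2 * (x - q)\<^sup>2 \<le> h x"
    by (rule ex_kinked_profile[OF \<alpha>, of "1 / 100"]) auto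
  interpret kinked_profile h p "1 - \<epsilon>"
    by unfold_locales (use \<alpha> hp in auto)
  obtain U where U: "continuous_on D U" "supported_on D U" "\<And>q. q \<in> D \<Longrightarrow> U q < 0"
    "\<And>a c d. a \<in> frontier D \<Longrightarrow> c < 0 \<Longrightarrow> d > 0 \<Longrightarrow> \<exists>q\<in>D. dist q a < d \<and> c < U q"
    using ex_supported_exhaustion by blast
  define u where "u q = ereal (U q)" for q
  have log_u: "(\<lambda>q. - log_ereal (- u q)) = (\<lambda>q. ereal (- ln (- U q)))"
    by (simp add: u_def log_ereal_def)
  have not_in: "a \<notin> D" if "a \<in> frontier D" for a
    using that open_D by (auto simp: frontier_def interior_open)
  have lim_u: "Limsup (at a within D) u = 0" if a: "a \<in> frontier D" for a
  proof (rule antisym)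
    have "\<forall>\<^sub>F q in at a within D. u q \<le> 0"
      using U(3) by (auto simp: eventually_at_filter u_def less_imp_le)
    then show "Limsup (at a within D) u \<le> 0" by (rule Limsup_bounded)
    show "0 \<le> Limsup (at a within D) u"
    proof (rule le_Limsup_withinI[OF not_in[OF a]])
      fix c :: ereal and d :: real assume "c < 0" "0 < d"
      from ereal_dense2[OF \<open>c < 0\<close>] obtain c' where "c < ereal c'" "ereal c' < 0" by blast
      with U(4)[OF a, of c' d] \<open>0 < d\<close> show "\<exists>q\<in>D. dist q a < d \<and> c < u q"
        by (force simp: u_def intro: less_trans)
    qed
  qed
  have lim_log: "Limsup (at a within D) (\<lambda>q. - log_ereal (- u q)) = \<infinity>" if a: "a \<in> frontier D" for a
  proof -
    have "\<infinity> \<le> Limsup (at a within D) (\<lambda>q. - log_ereal (- u q))"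
    proof (rule le_Limsup_withinI[OF not_in[OF a]])
      fix c :: ereal and d :: real assume "c < \<infinity>" "0 < d"
      from ereal_dense2[OF \<open>c < \<infinity>\<close>] obtain c' where c': "c < ereal c'" by blast
      obtain q where q: "q \<in> D" "dist q a < d" "- exp (- c') < U q"
        using U(4)[OF a, of "- exp (- c')" d] \<open>0 < d\<close> by auto
      have "ln (- U q) < ln (exp (- c'))" using q U(3)[OF q(1)] by (subst ln_less_cancel_iff) auto
      then have "c' < - ln (- U q)" by simp
      then have "c < ereal (- ln (- U q))" using c' by (meson ereal_less(2) less_ereal.simps(1) less_trans)
      then show "\<exists>q\<in>D. dist q a < d \<and> c < - log_ereal (- u q)"
        using q log_u by (metis (no_types, lifting))
    qed
    then show ?thesis by simp
  qed
  have "continuous_on D (\<lambda>q. - ln (- U q))"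
    using U(1) by (intro continuous_intros) (use U(3) in force)+
  then have "plurisubharmonic_on D (\<lambda>q. - log_ereal (- u q))"
    unfolding log_u using supported_on_ln[OF U(2,3)] by (rule plurisubharmonic_on_supported)
  moreover have "plurisubharmonic_on D u"
    unfolding u_def[abs_def] using U(1,2) by (rule plurisubharmonic_on_supported)
  ultimately show ?thesis
    using domain_D bounded_D not_pseudoconvex_D C1_holder_boundary_D lim_u lim_log U(3)
    by (intro exI[of _ D] exI[of _ u]) (auto simp: u_def)
qed

end
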